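(* Let $s\ge 2$ and let $H$ be a finite linear $s$-uniform hypergraph whose line graph $L(H)$ is a cograph. Then $$(s+1)\operatorname{rank}_{\mathbb R}N(H)\ \ge\ s\,|E(H)|.$$ Equality holds if and only if every edge-containing component of $H$ is a Steiner system $S(2,s,s^2)$.
   Context: A hypergraph is $s$-uniform if every edge has exactly $s$ vertices, and linear if any two distinct edges share at most one vertex. $N(H)$ is the edge--vertex incidence matrix (rows indexed by $E(H)$), after isolated vertices are removed; rank is over $\mathbb R$. The line graph $L(H)$ has vertex set $E(H)$, two distinct edges being adjacent when they intersect. A cograph is a graph with no induced path on four vertices. A Steiner system $S(2,s,s^2)$ is a hypergraph on $s^2$ points with blocks of size $s$ such that every pair of distinct points lies in exactly one block (an affine plane of order $s$). *)

theory Defs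
  imports "Jordan_Normal_Form.DL_Rank"
begin

type_synonym 'v hypergraph = "'v set \<times> 'v set set"

abbreviation verts :: "'v hypergraph \<Rightarrow> 'v set" where
  "verts \<equiv> fst"

abbreviation edges :: "'v hypergraph \<Rightarrow> 'v set set" where
  "edges \<equiv> snd"

text \<open>Edges form a set: parallel edges cannot occur in a linear \<open>s\<close>-uniform hypergraph
  with \<open>s \<ge> 2\<close>, since they would share \<open>s\<close> vertices.\<close>

definition finite_hypergraph :: "'v hypergraph \<Rightarrow> bool" where
  "finite_hypergraph H \<longleftrightarrow> finite (verts H) \<and> (\<forall>e \<in> edges H. e \<subseteq> verts H)"

definition uniform_hypergraph :: "nat \<Rightarrow> 'v hypergraph \<Rightarrow> bool" where
  "uniform_hypergraph s H \<longleftrightarrow> (\<forall>e \<in> edges H. card e = s)"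

definition linear_hypergraph :: "'v hypergraph \<Rightarrow> bool" where
  "linear_hypergraph H \<longleftrightarrow>
     (\<forall>e \<in> edges H. \<forall>f \<in> edges H. e \<noteq> f \<longrightarrow> card (e \<inter> f) \<le> 1)"

definition nonisolated_verts :: "'v hypergraph \<Rightarrow> 'v set" where
  "nonisolated_verts H = {v \<in> verts H. \<exists>e \<in> edges H. v \<in> e}"

text \<open>The incidence matrix is taken with respect to an ordering \<open>es\<close> of the edges (rows)
  and an ordering \<open>vs\<close> of the non-isolated vertices (columns).\<close>

definition incidence_orderings :: "'v hypergraph \<Rightarrow> 'v set list \<Rightarrow> 'v list \<Rightarrow> bool" where
  "incidence_orderings H es vs \<longleftrightarrow>
     distinct es \<and> set es = edges H \<and> distinct vs \<and> set vs = nonisolated_verts H"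

definition incidence_matrix :: "'v set list \<Rightarrow> 'v list \<Rightarrow> real mat" where
  "incidence_matrix es vs =
     mat (length es) (length vs) (\<lambda>(i, j). if vs ! j \<in> es ! i then 1 else 0)"

text \<open>The first argument of \<^const>\<open>vec_space.rank\<close> is the dimension of the
  column vectors, i.e. the number of rows.\<close>

definition mat_rank :: "real mat \<Rightarrow> nat" where
  "mat_rank A = vec_space.rank (dim_row A) A"

text \<open>A simple graph is given by its vertex set and its adjacency relation.\<close>

definition induced_P4 :: "'a set \<Rightarrow> ('a \<Rightarrow> 'a \<Rightarrow> bool) \<Rightarrow> (nat \<Rightarrow> 'a) \<Rightarrow> bool" where
  "induced_P4 X adj p \<longleftrightarrow>
     p ` {..<4} \<subseteq> X \<and> inj_on p {..<4} \<and>
     (\<forall>i<4. \<forall>j<4. adj (p i) (p j) \<longleftrightarrow> j = Suc i \<or> i = Suc j)"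

definition cograph :: "'a set \<Rightarrow> ('a \<Rightarrow> 'a \<Rightarrow> bool) \<Rightarrow> bool" where
  "cograph X adj \<longleftrightarrow> \<not> (\<exists>p. induced_P4 X adj p)"

text \<open>Adjacency in the line graph, whose vertex set is \<^term>\<open>edges H\<close>.\<close>

definition line_adj :: "'v set \<Rightarrow> 'v set \<Rightarrow> bool" where
  "line_adj e f \<longleftrightarrow> e \<noteq> f \<and> e \<inter> f \<noteq> {}"

definition coedge_rel :: "'v hypergraph \<Rightarrow> ('v \<times> 'v) set" where
  "coedge_rel H = {(u, v). \<exists>e \<in> edges H. u \<in> e \<and> v \<in> e}"

text \<open>An isolated vertex forms a component without edges.\<close>

definition components :: "'v hypergraph \<Rightarrow> 'v hypergraph set" where
  "components H =
     (\<lambda>C. (C, {e \<in> edges H. e \<subseteq> C})) ` ((\<lambda>u. (coedge_rel H)\<^sup>* `` {u}) ` verts H)"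

text \<open>Steiner system \<open>S(2,k,n)\<close>.\<close>

definition steiner_2_system :: "nat \<Rightarrow> nat \<Rightarrow> 'v hypergraph \<Rightarrow> bool" where
  "steiner_2_system k n S \<longleftrightarrow>
     finite_hypergraph S \<and> card (verts S) = n \<and> uniform_hypergraph k S \<and>
     (\<forall>x \<in> verts S. \<forall>y \<in> verts S. x \<noteq> y \<longrightarrow> (\<exists>!B. B \<in> edges S \<and> x \<in> B \<and> y \<in> B))"

end

theory Submission
  imports Defs
begin

text \<open>
  Let \<open>M = N N\<^sup>T\<close>. The bound says that \<open>ker M\<close> has dimension at most \<open>|E|/(s + 1)\<close>. A cograph is built
  from single vertices by disjoint unions and joins, and two edges from the two sides of a join meet
  in exactly one point, so there \<open>M\<close> acts between the sides as the all-ones matrix. Hence for a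
  subfamily \<open>F\<close> it suffices to follow \<open>dim ker M\<^sub>F\<close> together with \<open>a = \<Sum>y\<close>, where \<open>M\<^sub>F y = 1\<close>: a disjoint
  union adds the values of \<open>a\<close>, a join adds the values of \<open>a / (1 - a)\<close>, and a join has new kernel
  vectors only if both parts have \<open>a = 1\<close>.

  While \<open>a < 1\<close>, induction gives \<open>s a + (s + 1) dim ker M\<^sub>F \<le> |F|\<close>. A join of \<open>t\<close> parts with \<open>a = 1\<close>
  gains \<open>t - 1\<close> kernel dimensions, but all these parts have the same \<open>z = N\<^sup>T y\<close>, so that every vertex
  in the support of \<open>z\<close> has degree at least \<open>t\<close>. As \<open>\<Sum>z = s\<close>, \<open>\<Sum>z\<^sup>2 = 1\<close> and \<open>z\<close> sums to 1 on every
  edge, this forces \<open>t \<le> s + 1\<close>, with equality only for an affine plane. Finally, a part with \<open>a > 1\<close> can only be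
  joined to parts with \<open>a < 1\<close>, because \<open>M\<close> is positive semidefinite.
\<close>

section \<open>Rank and independent rows\<close>

text \<open>Induction on the equations. With one equation \<open>w\<close> set aside, there is a
  solution \<open>x\<close> with some \<open>x r \<noteq> 0\<close>, and then a second one
  \<open>y\<close> vanishing at \<open>r\<close>. The combination
  \<open>\<beta> * y - \<alpha> * x\<close> also satisfies \<open>w\<close>; it is nonzero at
  \<open>r\<close> if \<open>\<alpha> \<noteq> 0\<close>, and otherwise it is a nonzero multiple of
  \<open>y\<close>.\<close>

lemma homogeneous_system_nontrivial_solution:
  fixes W :: "('i \<Rightarrow> real) set"
  assumes "finite W" "finite R" "card W < card R"
  shows "\<exists>x. (\<forall>i. i \<notin> R \<longrightarrow> x i = 0) \<and> (\<exists>i\<in>R. x i \<noteq> 0) \<and> (\<forall>w\<in>W. (\<Sum>i\<in>R. x i * w i) = 0)"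
  using assms
proof (induction W arbitrary: R rule: finite_induct)
  case empty
  then obtain r where r: "r \<in> R" by (metis card.empty less_numeral_extra(3) all_not_in_conv)
  show ?case by (rule exI[of _ "\<lambda>i. if i = r then 1 else 0"]) (use r in auto)
next
  case (insert w W)
  have cW: "card W < card R" using insert by simp
  then obtain x where x: "\<forall>i. i \<notin> R \<longrightarrow> x i = 0" "\<exists>i\<in>R. x i \<noteq> 0" "\<forall>u\<in>W. (\<Sum>i\<in>R. x i * u i) = 0"
    using insert.IH[OF insert.prems(1)] by blast
  obtain r where r: "r \<in> R" "x r \<noteq> 0" using x by blast
  have "card W < card (R - {r})" using insert r by (simp add: card_Diff_singleton)
  then obtain y where y: "\<forall>i. i \<notin> R - {r} \<longrightarrow> y i = 0" "\<exists>i\<in>R - {r}. y i \<noteq> 0"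
      "\<forall>u\<in>W. (\<Sum>i\<in>R - {r}. y i * u i) = 0"
    using insert.IH[of "R - {r}"] insert.prems by blast
  have yr: "(\<Sum>i\<in>R. y i * u i) = (\<Sum>i\<in>R - {r}. y i * u i)" for u
    using y insert.prems r by (simp add: sum.remove)
  define \<alpha> where "\<alpha> = (\<Sum>i\<in>R. y i * w i)"
  define \<beta> where "\<beta> = (\<Sum>i\<in>R. x i * w i)"
  show ?case
  proof (cases "\<beta> = 0")
    case True
    then show ?thesis using x unfolding \<beta>_def by blast
  next
    case False
    define c where "c i = \<beta> * y i - \<alpha> * x i" for i
    have lin: "(\<Sum>i\<in>R. c i * u i) = \<beta> * (\<Sum>i\<in>R. y i * u i) - \<alpha> * (\<Sum>i\<in>R. x i * u i)" for u
      unfolding c_def by (simp add: algebra_simps sum_subtractf sum_distrib_left)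
    have "\<exists>i\<in>R. c i \<noteq> 0"
    proof (cases "\<alpha> = 0")
      case True
      then show ?thesis using False y by (auto simp: c_def)
    next
      case F: False
      have "c r = - \<alpha> * x r" using y by (simp add: c_def)
      then show ?thesis using F r by force
    qed
    moreover have "\<forall>u\<in>insert w W. (\<Sum>i\<in>R. c i * u i) = 0"
      using x y by (auto simp: lin yr[symmetric] \<alpha>_def \<beta>_def)
    moreover have "\<forall>i. i \<notin> R \<longrightarrow> c i = 0" using x y by (auto simp: c_def)
    ultimately show ?thesis by blast
  qed
qed

text \<open>\<open>rank\<close> is a column rank, while \<open>R\<close> indexes independent rows.
  If \<open>R\<close> were larger than a maximal independent set \<open>S\<close> of columns, some
  nonzero \<open>x\<close> on \<open>R\<close> would be orthogonal to all of \<open>S\<close>, hence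
  to every column, which is a dependency among the rows.\<close>

lemma card_independent_rows_le_rank:
  fixes A :: "real mat"
  assumes A: "A \<in> carrier_mat n nc" and R: "R \<subseteq> {..<n}"
    and indep: "\<And>x. (\<And>i. i \<notin> R \<Longrightarrow> x i = 0) \<Longrightarrow> (\<And>j. j < nc \<Longrightarrow> (\<Sum>i\<in>R. x i * A $$ (i, j)) = 0)
      \<Longrightarrow> (\<And>i. i \<in> R \<Longrightarrow> x i = 0)"
  shows "card R \<le> vec_space.rank n A"
proof (rule ccontr)
  interpret vec_space "TYPE(real)" n .
  assume neg: "\<not> card R \<le> rank A"
  have finR: "finite R" using R finite_subset by blast
  have cA: "set (cols A) \<subseteq> carrier_vec n" using cols_dim A by blast
  obtain S where mx: "maximal S (\<lambda>T. T \<subseteq> set (cols A) \<and> lin_indpt T)"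
    using maximal_exists[of "(\<lambda>T. T \<subseteq> set (cols A) \<and> lin_indpt T)" "card (set (cols A))" "{}"]
    by (meson List.finite_set card_mono empty_iff empty_subsetI finite_lin_indpt2 rev_finite_subset)
  have S: "S \<subseteq> set (cols A)" "lin_indpt S" using mx by (auto simp: maximal_def)
  have finS: "finite S" using S finite_subset by blast
  have SA: "S \<subseteq> carrier_vec n" using S cA by blast
  have "card S < card R" using neg rank_card_indpt[OF A mx] by simp
  then have "card ((\<lambda>w i. w $ i) ` S) < card R"
    using card_image_le[OF finS, of "\<lambda>w i. w $ i"] by linarith
  then obtain x where x: "\<forall>i. i \<notin> R \<longrightarrow> x i = 0" "\<exists>i\<in>R. x i \<noteq> 0"
      "\<And>w. w \<in> S \<Longrightarrow> (\<Sum>i\<in>R. x i * w $ i) = 0"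
    using homogeneous_system_nontrivial_solution[of "(\<lambda>w i. w $ i) ` S" R] finS finR by auto
  have sub: "set (cols A) \<subseteq> span S"
  proof
    fix c assume c: "c \<in> set (cols A)"
    show "c \<in> span S"
    proof (rule ccontr)
      assume nc: "c \<notin> span S"
      have "c \<in> carrier_vec n" using c cA by blast
      then have "lin_indpt (S \<union> {c})" "c \<notin> S"
        using lin_dep_iff_in_span[of S c] nc SA S span_mem[of S c] by auto
      then show False using mx c S unfolding maximal_def by blast
    qed
  qed
  have "(\<Sum>i\<in>R. x i * A $$ (i, j)) = 0" if j: "j < nc" for j
  proof -
    have "col A j \<in> span S" using sub j A by (auto simp: cols_def)
    then obtain a where a: "col A j = lincomb a S"
      using finite_span[OF finS] SA by auto
    have ent: "A $$ (i, j) = (\<Sum>w\<in>S. a w * w $ i)" if "i \<in> R" for i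
    proof -
      have "i < n" using that R by blast
      have "A $$ (i, j) = col A j $ i" using A j \<open>i < n\<close> by simp
      also have "\<dots> = (\<Sum>w\<in>S. a w * w $ i)" unfolding a by (rule lincomb_index[OF \<open>i < n\<close> SA])
      finally show ?thesis .
    qed
    have "(\<Sum>i\<in>R. x i * A $$ (i, j)) = (\<Sum>i\<in>R. \<Sum>w\<in>S. a w * (x i * w $ i))"
      by (intro sum.cong refl) (simp add: ent sum_distrib_left algebra_simps)
    also have "\<dots> = (\<Sum>w\<in>S. a w * (\<Sum>i\<in>R. x i * w $ i))"
      by (subst sum.swap) (simp add: sum_distrib_left)
    finally show ?thesis using x(3) by simp
  qed
  then show False using indep[of x] x by blast
qed

section \<open>Graphs without induced paths on four vertices\<close>

text \<open>An induced path with named vertices instead of an indexing. Adjacency is listed in one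
  direction only, so symmetry and irreflexivity enter when passing to
  \<open>induced_P4\<close>.\<close>

definition P4_in :: "'a set \<Rightarrow> ('a \<Rightarrow> 'a \<Rightarrow> bool) \<Rightarrow> bool" where
  "P4_in X adj \<longleftrightarrow> (\<exists>a\<in>X. \<exists>b\<in>X. \<exists>c\<in>X. \<exists>d\<in>X. distinct [a, b, c, d] \<and>
     adj a b \<and> adj b c \<and> adj c d \<and> \<not> adj a c \<and> \<not> adj a d \<and> \<not> adj b d)"

lemma P4_inI:
  assumes "a \<in> X" "b \<in> X" "c \<in> X" "d \<in> X" "distinct [a, b, c, d]"
    "adj a b" "adj b c" "adj c d" "\<not> adj a c" "\<not> adj a d" "\<not> adj b d"
  shows "P4_in X adj"
  using assms unfolding P4_in_def by blast

lemma P4_in_imp_induced_P4: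
  assumes "symp adj" "irreflp adj" "P4_in X adj"
  shows "\<exists>p. induced_P4 X adj p"
proof -
  obtain a b c d where X: "a \<in> X" "b \<in> X" "c \<in> X" "d \<in> X" and dist: "distinct [a, b, c, d]"
    and adj: "adj a b" "adj b c" "adj c d" "\<not> adj a c" "\<not> adj a d" "\<not> adj b d"
    using assms(3) unfolding P4_in_def by blast
  have nadj: "adj b a" "adj c b" "adj d c" "\<not> adj c a" "\<not> adj d a" "\<not> adj d b" "\<not> adj u u" for u
    using adj sympD[OF assms(1)] irreflpD[OF assms(2)] by blast+
  define p where "p = (\<lambda>i. [a, b, c, d] ! i)"
  have four: "{..<4::nat} = {0, 1, 2, 3}" by auto
  have all4: "(\<forall>i<4. Q i) \<longleftrightarrow> Q 0 \<and> Q 1 \<and> Q 2 \<and> Q (3::nat)" for Q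
  proof -
    have "(\<forall>i<4. Q i) \<longleftrightarrow> (\<forall>i\<in>{..<4}. Q i)" by auto
    then show ?thesis unfolding four by simp
  qed
  have "p ` {..<4} \<subseteq> X" "inj_on p {..<4}"
    unfolding four using X dist by (auto simp: p_def inj_on_def)
  moreover have "\<forall>i<4. \<forall>j<4. adj (p i) (p j) \<longleftrightarrow> j = Suc i \<or> i = Suc j"
    unfolding all4 p_def using adj nadj by simp
  ultimately have "induced_P4 X adj p" unfolding induced_P4_def by blast
  then show ?thesis by blast
qed

text \<open>Applied to \<open>co_adj adj\<close>, this says that the graph is disconnected, so both
  outcomes of a cograph decomposition share one notion.\<close>

definition is_join :: "'a set \<Rightarrow> ('a \<Rightarrow> 'a \<Rightarrow> bool) \<Rightarrow> bool" where
  "is_join X adj \<longleftrightarrow> (\<exists>P Q. P \<noteq> {} \<and> Q \<noteq> {} \<and> P \<inter> Q = {} \<and> P \<union> Q = X \<and>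
     (\<forall>p\<in>P. \<forall>q\<in>Q. adj p q))"

lemma is_joinI:
  assumes "P \<noteq> {}" "Q \<noteq> {}" "P \<inter> Q = {}" "P \<union> Q = X" "\<And>p q. p \<in> P \<Longrightarrow> q \<in> Q \<Longrightarrow> adj p q"
  shows "is_join X adj"
  unfolding is_join_def
  by (rule exI[of _ P], rule exI[of _ Q]) (simp add: assms)

abbreviation co_adj :: "('a \<Rightarrow> 'a \<Rightarrow> bool) \<Rightarrow> 'a \<Rightarrow> 'a \<Rightarrow> bool" where
  "co_adj adj \<equiv> \<lambda>u v. u \<noteq> v \<and> \<not> adj u v"

text \<open>The path on four vertices is self-complementary: the complement of the path a, b, c, d
  is the path b, d, a, c.\<close>

lemma P4_in_complement:
  assumes "symp adj" "P4_in X (co_adj adj)"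
  shows "P4_in X adj"
proof -
  obtain a b c d where X: "a \<in> X" "b \<in> X" "c \<in> X" "d \<in> X" and dist: "distinct [a, b, c, d]"
    and "co_adj adj a b" "co_adj adj b c" "co_adj adj c d"
      "\<not> co_adj adj a c" "\<not> co_adj adj a d" "\<not> co_adj adj b d"
    using assms(2) unfolding P4_in_def by blast
  then have "\<not> adj a b" "\<not> adj b c" "\<not> adj c d" "adj a c" "adj a d" "adj b d"
    by simp_all
  then show ?thesis
    using X dist sympD[OF assms(1)] by (intro P4_inI[of b X d a c]) (simp_all, blast+)
qed

text \<open>If \<open>v\<close> is adjacent to all of \<open>X\<close>, it splits off as a join.
  Otherwise one side, say \<open>P\<close>, contains a non-neighbour of \<open>v\<close>. If
  \<open>v\<close> has no neighbour in \<open>Q\<close>, then \<open>Q\<close> splits off; if it has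
  a neighbour \<open>c\<close> there, an edge from a non-neighbour \<open>b\<close> to a neighbour
  \<open>a\<close> inside \<open>P\<close> would give the induced path b, a, v, c, so the
  non-neighbours in \<open>P\<close> split off.\<close>

lemma no_P4_insert_join:
  assumes sym: "symp adj" and no: "\<not> P4_in (insert v X) adj" and v: "v \<notin> X"
    and PQ: "P \<noteq> {}" "Q \<noteq> {}" "P \<inter> Q = {}" "P \<union> Q = X" "\<And>p q. p \<in> P \<Longrightarrow> q \<in> Q \<Longrightarrow> \<not> adj p q"
  shows "is_join (insert v X) adj \<or> is_join (insert v X) (co_adj adj)"
proof -
  have flip: "adj x y \<longleftrightarrow> adj y x" for x y using sym by (meson sympD)
  define N where "N = {u. adj v u}"
  \<comment> \<open>The two sides are quantified afresh so that the claim also applies with their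
    roles exchanged.\<close>
  have main: "is_join (insert v X) (co_adj adj)"
    if PQ: "P \<inter> Q = {}" "Q \<noteq> {}" "P \<union> Q = X" "\<And>p q. p \<in> P \<Longrightarrow> q \<in> Q \<Longrightarrow> \<not> adj p q"
      and ne: "P - N \<noteq> {}" for P Q
  proof (cases "Q \<inter> N = {}")
    case True
    then show ?thesis
      by (intro is_joinI[of "insert v P" Q]) (use PQ v in \<open>auto simp: N_def\<close>)
  next
    case False
    then obtain c where c: "c \<in> Q" "adj v c" by (auto simp: N_def)
    show ?thesis
    proof (cases "\<exists>b\<in>P - N. \<exists>a\<in>P \<inter> N. adj b a")
      case True
      then obtain a b where ab: "b \<in> P" "\<not> adj v b" "a \<in> P" "adj v a" "adj b a"
        by (auto simp: N_def)
      have "adj a v" "\<not> adj b v" "\<not> adj a c" "\<not> adj b c" "v \<noteq> a" "v \<noteq> b" "v \<noteq> c"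
        "a \<noteq> b" "a \<noteq> c" "b \<noteq> c" "a \<in> X" "b \<in> X" "c \<in> X"
        using ab c PQ v flip by blast+
      then have "P4_in (insert v X) adj"
        using ab c by (intro P4_inI[of b _ a v c]) simp_all
      with no show ?thesis by contradiction
    next
      case False
      then show ?thesis
        by (intro is_joinI[of "P - N" "insert v (X - (P - N))"])
           (use PQ v ne flip in \<open>unfold N_def, blast+\<close>)
    qed
  qed
  show ?thesis
  proof (cases "P - N = {} \<and> Q - N = {}")
    case True
    then have "is_join (insert v X) adj"
      by (intro is_joinI[of "{v}" X]) (use PQ v in \<open>auto simp: N_def\<close>)
    then show ?thesis ..
  next
    case False
    have QP: "\<And>p q. p \<in> Q \<Longrightarrow> q \<in> P \<Longrightarrow> \<not> adj p q" using PQ sympD[OF sym] by blast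
    show ?thesis
    proof (cases "P - N = {}")
      case True
      have "Q \<inter> P = {}" "Q \<union> P = X" using PQ by auto
      then show ?thesis using main[of Q P] PQ(1) QP False True by blast
    next
      case F: False
      show ?thesis using main[OF PQ(3) PQ(2) PQ(4) PQ(5) F] by blast
    qed
  qed
qed

text \<open>Seinsche's theorem. The class is closed under complementation, so the deleted vertex may be
  put back into a graph whose smaller part is disconnected.\<close>

theorem no_P4_join:
  assumes "finite X" "symp adj" "irreflp adj" "\<not> P4_in X adj" "card X \<ge> 2"
  shows "is_join X adj \<or> is_join X (co_adj adj)"
  using assms
proof (induction X rule: finite_induct)
  case empty
  then show ?case by simp
next
  case (insert v X)
  have sym: "symp adj" "symp (co_adj adj)" using insert by (auto simp: symp_def)
  have coco: "co_adj (co_adj adj) = adj"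
    using irreflpD[OF insert.prems(2)] by (intro ext) auto
  show ?case
  proof (cases "card X \<ge> 2")
    case False
    then have "card X = 1" using insert by simp
    then obtain u where u: "X = {u}" using card_1_singletonE by blast
    then have "v \<noteq> u" using insert by blast
    then have "is_join (insert v X) (if adj v u then adj else co_adj adj)"
      unfolding u by (intro is_joinI[of "{v}" "{u}"]) auto
    then show ?thesis by (cases "adj v u") auto
  next
    case True
    have no: "\<not> P4_in X adj" using insert.prems unfolding P4_in_def by blast
    then have "is_join X adj \<or> is_join X (co_adj adj)"
      using insert.IH True insert.prems by blast
    then show ?thesis
    proof
      assume "is_join X (co_adj adj)"
      then obtain P Q where PQ: "P \<noteq> {}" "Q \<noteq> {}" "P \<inter> Q = {}" "P \<union> Q = X"
        "\<And>p q. p \<in> P \<Longrightarrow> q \<in> Q \<Longrightarrow> \<not> adj p q"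
        unfolding is_join_def by blast
      then show ?thesis using no_P4_insert_join[OF sym(1) insert.prems(3) insert.hyps(2)] by blast
    next
      assume "is_join X adj"
      then obtain P Q where PQ: "P \<noteq> {}" "Q \<noteq> {}" "P \<inter> Q = {}" "P \<union> Q = X"
        "\<And>p q. p \<in> P \<Longrightarrow> q \<in> Q \<Longrightarrow> \<not> co_adj adj p q"
        unfolding is_join_def by blast
      have "\<not> P4_in (insert v X) (co_adj adj)" using insert.prems P4_in_complement sym by blast
      then show ?thesis using no_P4_insert_join[OF sym(2) _ insert.hyps(2) PQ]
        unfolding coco by blast
    qed
  qed
qed

section \<open>The Gram operator of a linear uniform family\<close>

locale uniform_linear_family =
  fixes E :: "'v set set" and s :: nat
  assumes finite_E: "finite E"
    and s_ge_2: "s \<ge> 2"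
    and card_edge: "e \<in> E \<Longrightarrow> card e = s"
    and card_inter_le: "e \<in> E \<Longrightarrow> f \<in> E \<Longrightarrow> e \<noteq> f \<Longrightarrow> card (e \<inter> f) \<le> 1"
begin

lemma finite_edge: "e \<in> E \<Longrightarrow> finite e"
  using card_edge s_ge_2 by (metis card.infinite not_numeral_le_zero)

lemma finite_vertices: "finite (\<Union>E)"
  using finite_E finite_edge by blast

lemma edge_eqI:
  assumes "e \<in> E" "f \<in> E" "x \<in> e" "x \<in> f" "y \<in> e" "y \<in> f" "x \<noteq> y"
  shows "e = f"
proof (rule ccontr)
  assume "e \<noteq> f"
  then have "card (e \<inter> f) \<le> 1" using assms card_inter_le by blast
  moreover have "card {x, y} \<le> card (e \<inter> f)"
    using assms finite_edge by (intro card_mono) auto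
  ultimately show False using assms by simp
qed

text \<open>The vector \<open>N\<^sup>T x\<close>. Correspondingly \<open>gram x\<close> is
  \<open>M x\<close> and \<open>form x y\<close> is the bilinear form of \<open>M\<close>, that is,
  the inner product of the two loads.\<close>

definition load :: "('v set \<Rightarrow> real) \<Rightarrow> 'v \<Rightarrow> real" where
  "load x v = (\<Sum>e\<in>E. if v \<in> e then x e else 0)"

definition total :: "('v set \<Rightarrow> real) \<Rightarrow> real" where
  "total x = (\<Sum>e\<in>E. x e)"

definition gram :: "('v set \<Rightarrow> real) \<Rightarrow> 'v set \<Rightarrow> real" where
  "gram x e = (\<Sum>v\<in>e. load x v)"

definition form :: "('v set \<Rightarrow> real) \<Rightarrow> ('v set \<Rightarrow> real) \<Rightarrow> real" where
  "form x y = (\<Sum>v\<in>\<Union>E. load x v * load y v)"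

text \<open>Vectors on a subfamily are extended by zero, so that \<open>M\<^sub>F\<close> is
  \<open>gram\<close> read off on the edges of \<open>F\<close>.\<close>

definition supported :: "('v set \<Rightarrow> real) \<Rightarrow> 'v set set \<Rightarrow> bool" where
  "supported x F \<longleftrightarrow> (\<forall>e. e \<notin> F \<longrightarrow> x e = 0)"

lemma load_lin: "load (\<lambda>e. a * x e + b * y e) v = a * load x v + b * load y v"
  unfolding load_def sum_distrib_left sum.distrib[symmetric]
  by (rule sum.cong) auto

lemma total_lin: "total (\<lambda>e. a * x e + b * y e) = a * total x + b * total y"
  unfolding total_def sum_distrib_left sum.distrib[symmetric] ..

lemma gram_lin: "gram (\<lambda>e. a * x e + b * y e) e = a * gram x e + b * gram y e"
  unfolding gram_def load_lin sum_distrib_left sum.distrib[symmetric] ..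

lemma form_sym: "form x y = form y x"
  unfolding form_def by (simp add: mult.commute)

lemma form_square_lin:
  "form (\<lambda>e. a * x e + b * y e) (\<lambda>e. a * x e + b * y e)
    = a\<^sup>2 * form x x + 2 * a * b * form x y + b\<^sup>2 * form y y"
  unfolding form_def load_lin sum_distrib_left sum.distrib[symmetric]
  by (rule sum.cong) (auto simp: power2_eq_square algebra_simps)

lemma form_nonneg: "form x x \<ge> 0"
  unfolding form_def by (intro sum_nonneg) simp

lemma form_eq_sum_gram: "form x y = (\<Sum>e\<in>E. x e * gram y e)"
proof -
  have "form x y = (\<Sum>v\<in>\<Union>E. \<Sum>e\<in>E. (if v \<in> e then x e * load y v else 0))"
    unfolding form_def load_def[of x] sum_distrib_right
    by (intro sum.cong) auto
  also have "\<dots> = (\<Sum>e\<in>E. \<Sum>v\<in>\<Union>E. if v \<in> e then x e * load y v else 0)"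
    by (rule sum.swap)
  also have "\<dots> = (\<Sum>e\<in>E. \<Sum>v\<in>e. x e * load y v)"
  proof (rule sum.cong[OF refl])
    fix e assume "e \<in> E"
    then have "\<Union>E \<inter> e = e" by blast
    then show "(\<Sum>v\<in>\<Union>E. if v \<in> e then x e * load y v else 0) = (\<Sum>v\<in>e. x e * load y v)"
      using sum.inter_restrict[OF finite_vertices, of "\<lambda>v. x e * load y v" e] by simp
  qed
  finally show ?thesis by (simp add: gram_def sum_distrib_left)
qed

text \<open>The entries of \<open>M\<close> are the intersection sizes. The set \<open>e\<close> may
  be any finite set; \<open>sum_load\<close> takes it to be the whole vertex set.\<close>

lemma gram_eq_sum_inter:
  assumes "finite e"
  shows "gram x e = (\<Sum>f\<in>E. real (card (e \<inter> f)) * x f)"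
proof -
  have "gram x e = (\<Sum>f\<in>E. \<Sum>v\<in>e. if v \<in> f then x f else 0)"
    unfolding gram_def load_def by (rule sum.swap)
  also have "\<dots> = (\<Sum>f\<in>E. \<Sum>v\<in>e \<inter> f. x f)"
    by (rule sum.cong[OF refl]) (rule sum.inter_restrict[OF assms, symmetric])
  finally show ?thesis by simp
qed

lemma sum_load: "(\<Sum>v\<in>\<Union>E. load x v) = s * total x"
proof -
  have "(\<Sum>v\<in>\<Union>E. load x v) = gram x (\<Union>E)" by (simp add: gram_def)
  also have "\<dots> = (\<Sum>f\<in>E. real s * x f)"
    unfolding gram_eq_sum_inter[OF finite_vertices]
  proof (intro sum.cong refl)
    fix f assume f: "f \<in> E"
    then have "\<Union>E \<inter> f = f" by blast
    then show "real (card (\<Union>E \<inter> f)) * x f = real s * x f" using card_edge[OF f] by simp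
  qed
  finally show ?thesis by (simp add: total_def sum_distrib_left)
qed

lemma load_nonneg: "(\<And>e. x e \<ge> 0) \<Longrightarrow> load x v \<ge> 0"
  unfolding load_def by (intro sum_nonneg) simp

lemma load_nonzero:
  assumes "load x v \<noteq> 0" "supported x F"
  obtains e where "e \<in> F" "v \<in> e"
proof -
  have "\<exists>e\<in>E. (if v \<in> e then x e else 0) \<noteq> 0"
    using assms(1) unfolding load_def by (rule contrapos_np) (intro sum.neutral, blast)
  then obtain e where "v \<in> e" "x e \<noteq> 0" by (auto split: if_splits)
  then show thesis using assms(2) that by (auto simp: supported_def)
qed

text \<open>\<open>form x x\<close> is the squared norm of \<open>load x\<close>. Once the load
  vanishes, so does the total, because the loads add up to \<open>s\<close> times the total.\<close>

lemma form_zero: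
  assumes "form x x = 0"
  shows "load x v = 0" "total x = 0"
proof -
  have "\<forall>v\<in>\<Union>E. load x v * load x v = 0"
    using assms finite_vertices unfolding form_def by (subst (asm) sum_nonneg_eq_0_iff) auto
  then have "\<forall>v\<in>\<Union>E. load x v = 0" by simp
  moreover have "load x v = 0" if "v \<notin> \<Union>E" for v
    unfolding load_def using that by (intro sum.neutral) auto
  ultimately have *: "load x v = 0" for v by blast
  show "load x v = 0" by (rule *)
  show "total x = 0" using sum_load[of x] s_ge_2 by (simp add: *)
qed

lemma form_const:
  assumes "supported x F" "\<And>e. e \<in> F \<Longrightarrow> gram y e = c"
  shows "form x y = c * total x"
  unfolding form_eq_sum_gram total_def sum_distrib_left
  by (intro sum.cong refl) (use assms in \<open>auto simp: supported_def\<close>)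

lemma supported_mono: "supported x F \<Longrightarrow> F \<subseteq> G \<Longrightarrow> supported x G"
  by (auto simp: supported_def)

lemma supported_lin:
  "supported x F \<Longrightarrow> supported y F \<Longrightarrow> supported (\<lambda>e. a * x e + b * y e) F"
  by (auto simp: supported_def)

text \<open>By linearity two distinct intersecting edges share exactly one vertex, so the block of
  \<open>M\<close> between the two sides of a join is all ones.\<close>

lemma gram_joined:
  assumes "supported x Q" "Q \<subseteq> E" "p \<in> E" "p \<notin> Q" "\<And>q. q \<in> Q \<Longrightarrow> p \<inter> q \<noteq> {}"
  shows "gram x p = total x"
  unfolding gram_eq_sum_inter[OF finite_edge[OF assms(3)]] total_def
proof (intro sum.cong refl)
  fix f assume f: "f \<in> E"
  show "real (card (p \<inter> f)) * x f = x f"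
  proof (cases "f \<in> Q")
    case True
    then have "p \<noteq> f" "p \<inter> f \<noteq> {}" using assms by blast+
    then have "card (p \<inter> f) = 1"
      using card_inter_le[OF assms(3) f] finite_edge[OF f]
      by (metis One_nat_def card_0_eq finite_Int le_antisym less_one not_le)
    then show ?thesis by simp
  next
    case False
    then show ?thesis using assms(1) by (simp add: supported_def)
  qed
qed

lemma gram_separated:
  assumes "supported x Q" "finite p" "\<And>q. q \<in> Q \<Longrightarrow> p \<inter> q = {}"
  shows "gram x p = 0"
  unfolding gram_eq_sum_inter[OF assms(2)]
proof (intro sum.neutral ballI)
  fix f show "real (card (p \<inter> f)) * x f = 0"
    using assms by (cases "f \<in> Q") (auto simp: supported_def)
qed

definition restrict_to :: "'v set set \<Rightarrow> ('v set \<Rightarrow> real) \<Rightarrow> 'v set \<Rightarrow> real" where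
  "restrict_to F x e = (if e \<in> F then x e else 0)"

lemma supported_restrict: "supported (restrict_to F x) F"
  by (simp add: supported_def restrict_to_def)

text \<open>The coefficients 1 make the sum an instance of \<open>gram_lin\<close> and
  \<open>total_lin\<close>.\<close>

lemma restrict_decomp:
  assumes "P \<inter> Q = {}" "supported x (P \<union> Q)"
  shows "x = (\<lambda>e. 1 * restrict_to P x e + 1 * restrict_to Q x e)"
  using assms by (auto simp: restrict_to_def supported_def fun_eq_iff)

text \<open>Dimensions of kernels are measured by coordinates: \<open>S\<close> determines \<open>F\<close> if a kernel vector on \<open>F\<close>
  vanishing on \<open>S\<close> is zero, so that \<open>card S\<close> bounds the dimension of the kernel.\<close>

definition determines :: "'v set set \<Rightarrow> 'v set set \<Rightarrow> bool" where
  "determines F S \<longleftrightarrow> S \<subseteq> F \<and>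
     (\<forall>x. supported x F \<longrightarrow> (\<forall>e\<in>F. gram x e = 0) \<longrightarrow> (\<forall>e\<in>S. x e = 0) \<longrightarrow> (\<forall>e. x e = 0))"

definition solves :: "'v set set \<Rightarrow> ('v set \<Rightarrow> real) \<Rightarrow> real \<Rightarrow> bool" where
  "solves F y a \<longleftrightarrow> supported y F \<and> (\<forall>e. y e \<ge> 0) \<and> (\<forall>e\<in>F. gram y e = 1) \<and> total y = a"

definition degree :: "'v set set \<Rightarrow> 'v \<Rightarrow> nat" where
  "degree F v = card {e \<in> F. v \<in> e}"

text \<open>Phrased locally, through the set of points collinear with \<open>v\<close>, rather than
  through connected components; such a star later turns out to be the component of
  \<open>v\<close>.\<close>

definition affine_planes :: "'v set set \<Rightarrow> bool" where
  "affine_planes F \<longleftrightarrow> (\<forall>v\<in>\<Union>F. card (\<Union>{e \<in> F. v \<in> e}) = s\<^sup>2 \<and>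
     (\<forall>x\<in>\<Union>{e \<in> F. v \<in> e}. \<forall>y\<in>\<Union>{e \<in> F. v \<in> e}. \<exists>e\<in>F. x \<in> e \<and> y \<in> e))"

text \<open>Solution total below 1, with \<open>card S\<close> standing in for the kernel dimension
  in the inequality that the induction carries.\<close>

definition light :: "'v set set \<Rightarrow> bool" where
  "light F \<longleftrightarrow> (\<exists>y a S. solves F y a \<and> 0 < a \<and> a < 1 \<and> determines F S \<and>
     real s * a + real ((s + 1) * card S) \<le> real (card F))"

text \<open>The number \<open>t\<close> counts the parts with solution total 1 that have been joined.\<close>

definition critical :: "'v set set \<Rightarrow> bool" where
  "critical F \<longleftrightarrow> (\<exists>y t S. solves F y 1 \<and> (\<forall>v. load y v \<noteq> 0 \<longrightarrow> t \<le> degree F v) \<and>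
     determines F S \<and> (s + 1) * card S + (s + 1) \<le> card F + t)"

text \<open>The target of the induction: the theorem's bound in terms of the kernel, together with
  the necessary condition for equality.\<close>

definition kernel_bounded :: "'v set set \<Rightarrow> bool" where
  "kernel_bounded F \<longleftrightarrow> (\<exists>S. determines F S \<and> (s + 1) * card S \<le> card F \<and>
     ((s + 1) * card S = card F \<longrightarrow> affine_planes F))"

text \<open>The inequality amounts to solution total \<open>> 1\<close>, but it passes to larger families without a solution
  having to be produced there.\<close>

definition dense :: "'v set set \<Rightarrow> bool" where
  "dense F \<longleftrightarrow> (\<exists>y. supported y F \<and> form y y < (total y)\<^sup>2)"

lemma solves_form: "solves F y a \<Longrightarrow> form y y = a"
  using form_const[of y F y 1] by (simp add: solves_def)

text \<open>By scaling, this says that no solution of \<open>M\<^sub>F x = 1\<close>, of whatever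
  signs, has total 1. Restrictions of kernel vectors of a join satisfy exactly the premises on each
  side.\<close>

definition rigid :: "'v set set \<Rightarrow> bool" where
  "rigid F \<longleftrightarrow> (\<forall>x. supported x F \<longrightarrow> (\<forall>e\<in>F. gram x e = total x) \<longrightarrow> total x = 0)"

text \<open>Evaluating \<open>form x y\<close> from either side gives
  \<open>total x * a = total x\<close>.\<close>

lemma rigid_solves:
  assumes "solves F y a" "a \<noteq> 1"
  shows "rigid F"
  unfolding rigid_def
proof (intro allI impI)
  fix x assume x: "supported x F" "\<forall>e\<in>F. gram x e = total x"
  have "form y x = total x * a"
    using form_const[of y F x "total x"] assms x by (simp add: solves_def)
  moreover have "form x y = 1 * total x"
    using form_const[of x F y 1] assms x by (simp add: solves_def)
  ultimately have "total x * a = total x" using form_sym[of x y] by simp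
  then show "total x = 0" using assms(2) by simp
qed

text \<open>A vector \<open>x\<close> with \<open>gram x = c\<close> on \<open>F\<close> and total
  \<open>c\<close> has \<open>form x x = c * c\<close> and \<open>form x y = c * T\<close>. The
  combination \<open>T x - c y\<close> then has form
  \<open>c\<^sup>2 * (form y y - T\<^sup>2)\<close>, which is negative unless
  \<open>c = 0\<close>.\<close>

lemma rigid_dense:
  assumes "dense F"
  shows "rigid F"
  unfolding rigid_def
proof (intro allI impI)
  fix x assume x: "supported x F" "\<forall>e\<in>F. gram x e = total x"
  obtain y where y: "supported y F" "form y y < (total y)\<^sup>2" using assms by (auto simp: dense_def)
  define c T where "c = total x" and "T = total y"
  have yx: "form x y = c * T" "form x x = c * c"
    using form_const[of y F x c] form_const[of x F x c] form_sym[of x y] x y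
    by (simp_all add: c_def T_def)
  have "0 \<le> T\<^sup>2 * form x x + 2 * T * (- c) * form x y + (- c)\<^sup>2 * form y y"
    using form_nonneg[of "\<lambda>e. T * x e + (- c) * y e"] unfolding form_square_lin .
  also have "\<dots> = c\<^sup>2 * (form y y - T\<^sup>2)" unfolding yx by (simp add: power2_eq_square algebra_simps)
  finally have "0 \<le> c\<^sup>2 * (form y y - T\<^sup>2)" .
  moreover have "form y y - T\<^sup>2 < 0" using y T_def by simp
  ultimately have "c\<^sup>2 \<le> 0" by (simp add: zero_le_mult_iff)
  then show "total x = 0" unfolding c_def by simp
qed

lemma dense_mono: "dense F \<Longrightarrow> F \<subseteq> G \<Longrightarrow> dense G"
  unfolding dense_def using supported_mono by blast

lemma solves_dense: "solves F y a \<Longrightarrow> a > 1 \<Longrightarrow> dense F"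
  unfolding dense_def
  by (rule exI[of _ y]) (auto simp: solves_form[of F y a] solves_def power2_eq_square)

lemma determinesD:
  assumes "determines F S" "supported x F" "\<And>e. e \<in> F \<Longrightarrow> gram x e = 0" "\<And>e. e \<in> S \<Longrightarrow> x e = 0"
  shows "x e = 0"
  using assms unfolding determines_def by blast

lemma determines_subset: "determines F S \<Longrightarrow> S \<subseteq> F"
  by (simp add: determines_def)

section \<open>Unions and joins\<close>

definition joined :: "'v set set \<Rightarrow> 'v set set \<Rightarrow> bool" where
  "joined P Q \<longleftrightarrow> P \<subseteq> E \<and> Q \<subseteq> E \<and> P \<inter> Q = {} \<and> (\<forall>p\<in>P. \<forall>q\<in>Q. p \<inter> q \<noteq> {})"

definition separated :: "'v set set \<Rightarrow> 'v set set \<Rightarrow> bool" where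
  "separated P Q \<longleftrightarrow> P \<subseteq> E \<and> Q \<subseteq> E \<and> P \<inter> Q = {} \<and> (\<forall>p\<in>P. \<forall>q\<in>Q. p \<inter> q = {})"

lemma joined_sym: "joined P Q \<Longrightarrow> joined Q P"
  unfolding joined_def by blast

lemma separated_sym: "separated P Q \<Longrightarrow> separated Q P"
  unfolding separated_def by blast

lemma card_Un_parts:
  assumes "P \<subseteq> E" "Q \<subseteq> E" "P \<inter> Q = {}"
  shows "card (P \<union> Q) = card P + card Q"
  using assms finite_E by (meson card_Un_disjoint finite_subset)

lemma joined_gram: "joined P Q \<Longrightarrow> supported x Q \<Longrightarrow> p \<in> P \<Longrightarrow> gram x p = total x"
  unfolding joined_def by (intro gram_joined) blast+

lemma separated_gram: "separated P Q \<Longrightarrow> supported x Q \<Longrightarrow> p \<in> P \<Longrightarrow> gram x p = 0"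
  unfolding separated_def by (intro gram_separated) (blast intro: finite_edge)+

lemma joined_form:
  "joined P Q \<Longrightarrow> supported x P \<Longrightarrow> supported y Q \<Longrightarrow> form x y = total x * total y"
  using form_const[of x P y "total y"] joined_gram[of P Q y] by simp

lemma kernel_total:
  assumes "supported x F" "\<And>e. e \<in> F \<Longrightarrow> gram x e = 0"
  shows "total x = 0"
  using form_zero(2)[of x] form_const[of x F x 0] assms by simp

text \<open>On one side, the other side contributes just its total, and the two totals cancel since
  a kernel vector has total 0.\<close>

lemma kernel_joined:
  assumes j: "joined P Q" and x: "supported x (P \<union> Q)" "\<And>e. e \<in> P \<union> Q \<Longrightarrow> gram x e = 0"
  shows "total (restrict_to P x) + total (restrict_to Q x) = 0"
    "e \<in> P \<Longrightarrow> gram (restrict_to P x) e = total (restrict_to P x)"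
    "e \<in> Q \<Longrightarrow> gram (restrict_to Q x) e = total (restrict_to Q x)"
proof -
  have "P \<inter> Q = {}" using j by (simp add: joined_def)
  note d = restrict_decomp[OF this x(1)]
  have g: "gram x e = gram (restrict_to P x) e + gram (restrict_to Q x) e" for e
    using gram_lin[of 1 "restrict_to P x" 1 "restrict_to Q x" e] d by simp
  have "total x = 0" using kernel_total[OF x] .
  then show t: "total (restrict_to P x) + total (restrict_to Q x) = 0"
    using total_lin[of 1 "restrict_to P x" 1 "restrict_to Q x"] d by simp
  show "gram (restrict_to P x) e = total (restrict_to P x)" if "e \<in> P"
    using g[of e] x(2)[of e] that t joined_gram[OF j supported_restrict, of e] by simp
  show "gram (restrict_to Q x) e = total (restrict_to Q x)" if "e \<in> Q"
    using g[of e] x(2)[of e] that t joined_gram[OF joined_sym[OF j] supported_restrict, of e] by simp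
qed

lemma determines_restrict:
  assumes P: "determines P S" and S: "\<And>e. e \<in> S \<Longrightarrow> x e = 0"
    and k: "\<And>e. e \<in> P \<Longrightarrow> gram (restrict_to P x) e = 0"
  shows "e \<in> P \<Longrightarrow> x e = 0"
proof -
  have "restrict_to P x e = 0" for e
    by (rule determinesD[OF P supported_restrict k]) (use S in \<open>auto simp: restrict_to_def\<close>)
  then show "e \<in> P \<Longrightarrow> x e = 0" by (metis restrict_to_def)
qed

text \<open>If the total on \<open>P\<close> vanishes, so does that on \<open>Q\<close>, and both
  restrictions are kernel vectors of their own parts.\<close>

lemma joined_kernel_zero:
  assumes j: "joined P Q" and P: "determines P S" and Q: "determines Q T"
    and x: "supported x (P \<union> Q)" "\<And>e. e \<in> P \<union> Q \<Longrightarrow> gram x e = 0"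
    and z: "\<And>e. e \<in> S \<union> T \<Longrightarrow> x e = 0" and t: "total (restrict_to P x) = 0"
  shows "x e = 0"
proof -
  note k = kernel_joined[OF j x]
  have "e \<in> P \<Longrightarrow> x e = 0" for e
    by (rule determines_restrict[OF P _ _, of x]) (use z k(2) t in auto)
  moreover have "e \<in> Q \<Longrightarrow> x e = 0" for e
    by (rule determines_restrict[OF Q _ _, of x]) (use z k(1,3) t in auto)
  ultimately show ?thesis using x(1) unfolding supported_def by blast
qed

lemma joined_determines:
  assumes j: "joined P Q" and r: "rigid P \<or> rigid Q"
    and P: "determines P S" and Q: "determines Q T"
  shows "determines (P \<union> Q) (S \<union> T)"
  unfolding determines_def
proof (intro conjI allI impI)
  show "S \<union> T \<subseteq> P \<union> Q" using P Q determines_subset by blast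
  fix x e assume x: "supported x (P \<union> Q)" "\<forall>e\<in>P \<union> Q. gram x e = 0" and z: "\<forall>e\<in>S \<union> T. x e = 0"
  have x2: "\<And>e. e \<in> P \<union> Q \<Longrightarrow> gram x e = 0" using x(2) by blast
  note k = kernel_joined[OF j x(1) x2]
  have "total (restrict_to P x) = 0 \<or> total (restrict_to Q x) = 0"
    using r k(2,3) supported_restrict unfolding rigid_def by blast
  then have "total (restrict_to P x) = 0" using k(1) by linarith
  then show "x e = 0" using joined_kernel_zero[OF j P Q x(1) x2] z by blast
qed

text \<open>Only the one linear functional \<open>total (restrict_to P x)\<close> separates kernel
  vectors of the join from pairs of kernel vectors of the parts, so one extra coordinate
  suffices.\<close>

lemma joined_determines_insert:
  assumes j: "joined P Q" and P: "determines P S" and Q: "determines Q T"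
  shows "\<exists>U. determines (P \<union> Q) U \<and> card U \<le> card S + card T + 1"
proof (cases "determines (P \<union> Q) (S \<union> T)")
  case True
  then show ?thesis using card_Un_le[of S T] by (metis le_add1 le_trans)
next
  case False
  have sub: "S \<union> T \<subseteq> P \<union> Q" using P Q determines_subset by blast
  obtain x e where x: "supported x (P \<union> Q)" "\<And>e. e \<in> P \<union> Q \<Longrightarrow> gram x e = 0"
    "\<And>e. e \<in> S \<union> T \<Longrightarrow> x e = 0" and e: "x e \<noteq> 0"
    using False sub unfolding determines_def by blast
  have ePQ: "e \<in> P \<union> Q" using x(1) e unfolding supported_def by blast
  let ?T = "\<lambda>x. total (restrict_to P x)"
  have "determines (P \<union> Q) (insert e (S \<union> T))"
    unfolding determines_def
  proof (intro conjI allI impI)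
    show "insert e (S \<union> T) \<subseteq> P \<union> Q" using sub ePQ by blast
    fix y f assume y: "supported y (P \<union> Q)" "\<forall>e\<in>P \<union> Q. gram y e = 0"
      and z: "\<forall>e\<in>insert e (S \<union> T). y e = 0"
    have y2: "\<And>e. e \<in> P \<union> Q \<Longrightarrow> gram y e = 0" using y(2) by blast
    \<comment> \<open>The combination has total 0 on \<open>P\<close> and vanishes on
      \<open>S \<union> T\<close>, hence is zero. At \<open>e\<close>, where \<open>y\<close>
      vanishes and \<open>x\<close> does not, this forces \<open>?T y = 0\<close>.\<close>
    define w where "w = (\<lambda>f. ?T x * y f + (- ?T y) * x f)"
    have "restrict_to P w = (\<lambda>f. ?T x * restrict_to P y f + (- ?T y) * restrict_to P x f)"
      by (auto simp: w_def restrict_to_def)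
    then have "?T w = ?T x * ?T y + (- ?T y) * ?T x"
      by (rule ssubst[of _ _ "\<lambda>u. total u = _"]) (rule total_lin)
    then have Tw: "?T w = 0" by simp
    have "supported w (P \<union> Q)" unfolding w_def using y(1) x(1) by (rule supported_lin)
    moreover have "gram w f = 0" if "f \<in> P \<union> Q" for f
      unfolding w_def gram_lin using x(2)[OF that] y2[OF that] by simp
    moreover have "w f = 0" if "f \<in> S \<union> T" for f
      unfolding w_def using x(3)[OF that] z that by simp
    ultimately have "w e = 0" using joined_kernel_zero[OF j P Q _ _ _ Tw] by blast
    then have "?T y = 0" using e z by (simp add: w_def)
    then show "y f = 0" using joined_kernel_zero[OF j P Q y(1) y2] z by blast
  qed
  moreover have "card (insert e (S \<union> T)) \<le> card S + card T + 1"
    using card_Un_le[of S T] card_insert_le_m1[of "card S + card T + 1" "S \<union> T" e] by simp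
  ultimately show ?thesis by blast
qed

lemma separated_determines:
  assumes s: "separated P Q" and P: "determines P S" and Q: "determines Q T"
  shows "determines (P \<union> Q) (S \<union> T)"
  unfolding determines_def
proof (intro conjI allI impI)
  show "S \<union> T \<subseteq> P \<union> Q" using P Q determines_subset by blast
  fix x e assume x: "supported x (P \<union> Q)" "\<forall>e\<in>P \<union> Q. gram x e = 0" and z: "\<forall>e\<in>S \<union> T. x e = 0"
  have "P \<inter> Q = {}" using s by (simp add: separated_def)
  note d = restrict_decomp[OF this x(1)]
  have g: "gram x e = gram (restrict_to P x) e + gram (restrict_to Q x) e" for e
    using gram_lin[of 1 "restrict_to P x" 1 "restrict_to Q x" e] d by simp
  have "gram (restrict_to P x) e = 0" if "e \<in> P" for e
    using g[of e] x(2) that separated_gram[OF s supported_restrict, of e] by simp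
  then have "e \<in> P \<Longrightarrow> x e = 0" for e
    by (rule determines_restrict[OF P, rotated]) (use z in auto)
  moreover have "gram (restrict_to Q x) e = 0" if "e \<in> Q" for e
    using g[of e] x(2) that separated_gram[OF separated_sym[OF s] supported_restrict, of e] by simp
  then have "e \<in> Q \<Longrightarrow> x e = 0" for e
    by (rule determines_restrict[OF Q, rotated]) (use z in auto)
  ultimately show "x e = 0" using x(1) unfolding supported_def by blast
qed

text \<open>Across a join the mixed form is the product of the totals, so the combination of
  \<open>x\<close> and \<open>y\<close> with total 0 would have negative form.\<close>

lemma dense_joined_contra:
  assumes j: "joined P Q" and P: "dense P"
    and y: "supported y Q" "form y y \<le> (total y)\<^sup>2" "total y \<noteq> 0"
  shows False
proof -
  obtain x where x: "supported x P" "form x x < (total x)\<^sup>2" using P by (auto simp: dense_def)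
  have "0 \<le> (total y)\<^sup>2 * form x x + 2 * total y * (- total x) * form x y + (- total x)\<^sup>2 * form y y"
    using form_nonneg[of "\<lambda>e. total y * x e + (- total x) * y e"] unfolding form_square_lin .
  also have "\<dots> = (total y)\<^sup>2 * form x x - 2 * (total x)\<^sup>2 * (total y)\<^sup>2 + (total x)\<^sup>2 * form y y"
    unfolding joined_form[OF j x(1) y(1)] by (simp add: power2_eq_square)
  also have "\<dots> < (total y)\<^sup>2 * (total x)\<^sup>2 - 2 * (total x)\<^sup>2 * (total y)\<^sup>2 + (total x)\<^sup>2 * (total y)\<^sup>2"
    by (intro add_less_le_mono diff_strict_right_mono mult_strict_left_mono mult_left_mono)
       (use x y in simp_all)
  finally show False by simp
qed

text \<open>The coefficients solve \<open>\<alpha> + \<beta> b = 1\<close> and \<open>\<alpha> a + \<beta> = 1\<close>.\<close>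

lemma solves_joined:
  assumes j: "joined P Q" and P: "solves P x a" and Q: "solves Q y b"
    and ab: "0 < a" "a < 1" "0 < b" "b < 1"
  shows "solves (P \<union> Q) (\<lambda>e. (1 - b) / (1 - a * b) * x e + (1 - a) / (1 - a * b) * y e)
    ((a + b - 2 * a * b) / (1 - a * b))"
proof -
  have ab1: "a * b < 1" using mult_strict_mono[of a 1 b 1] ab by simp
  have sup: "supported x (P \<union> Q)" "supported y (P \<union> Q)"
    using P Q supported_mono unfolding solves_def by blast+
  have gx: "e \<in> P \<Longrightarrow> gram x e = 1" "e \<in> Q \<Longrightarrow> gram x e = a"
    and gy: "e \<in> Q \<Longrightarrow> gram y e = 1" "e \<in> P \<Longrightarrow> gram y e = b" for e
    using P Q joined_gram[OF j, of y e] joined_gram[OF joined_sym[OF j], of x e]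
    unfolding solves_def by auto
  have nz: "1 - a * b \<noteq> 0" using ab1 by simp
  show ?thesis
    unfolding solves_def gram_lin total_lin
  proof (intro conjI allI ballI)
    show "supported (\<lambda>e. (1 - b) / (1 - a * b) * x e + (1 - a) / (1 - a * b) * y e) (P \<union> Q)"
      using sup by (rule supported_lin)
    show "0 \<le> (1 - b) / (1 - a * b) * x e + (1 - a) / (1 - a * b) * y e" for e
      using P Q ab ab1 by (simp add: solves_def)
    show "(1 - b) / (1 - a * b) * gram x e + (1 - a) / (1 - a * b) * gram y e = 1"
      if "e \<in> P \<union> Q" for e
    proof -
      have "(1 - b) * 1 + (1 - a) * b = 1 - a * b" "(1 - b) * a + (1 - a) * 1 = 1 - a * b"
        by (simp_all add: algebra_simps)
      then have "(1 - b) * gram x e + (1 - a) * gram y e = 1 - a * b"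
        using that gx[of e] gy[of e] by (elim UnE) simp_all
      then show ?thesis using nz by (simp add: add_divide_distrib[symmetric])
    qed
    show "(1 - b) / (1 - a * b) * total x + (1 - a) / (1 - a * b) * total y
      = (a + b - 2 * a * b) / (1 - a * b)"
      using P Q nz by (simp add: solves_def add_divide_distrib[symmetric] algebra_simps)
  qed
qed

lemma solves_separated:
  assumes s: "separated P Q" and P: "solves P x a" and Q: "solves Q y b"
  shows "solves (P \<union> Q) (\<lambda>e. 1 * x e + 1 * y e) (a + b)"
proof -
  have sup: "supported x (P \<union> Q)" "supported y (P \<union> Q)"
    using P Q supported_mono unfolding solves_def by blast+
  have gx: "e \<in> P \<Longrightarrow> gram x e = 1" "e \<in> Q \<Longrightarrow> gram x e = 0"
    and gy: "e \<in> Q \<Longrightarrow> gram y e = 1" "e \<in> P \<Longrightarrow> gram y e = 0" for e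
    using P Q separated_gram[OF s, of y e] separated_gram[OF separated_sym[OF s], of x e]
    unfolding solves_def by auto
  show ?thesis
    unfolding solves_def gram_lin total_lin
    using P Q gx gy supported_lin[OF sup, of 1 1] by (auto simp: solves_def)
qed

section \<open>Critical families\<close>

text \<open>Edges through \<open>v\<close> share no other vertex, so they are pairwise disjoint once
  \<open>v\<close> is removed.\<close>

lemma sum_Union_star:
  assumes D: "D \<subseteq> E" "\<And>e. e \<in> D \<Longrightarrow> v \<in> e" and f: "\<And>u. f u \<ge> (0::real)"
  shows "(\<Sum>u\<in>(\<Union>D) - {v}. f u) = (\<Sum>e\<in>D. \<Sum>u\<in>e - {v}. f u)"
proof -
  have "(\<Union>D) - {v} = (\<Union>e\<in>D. e - {v})" by blast
  moreover have "(\<Sum>u\<in>(\<Union>e\<in>D. e - {v}). f u) = (\<Sum>e\<in>D. \<Sum>u\<in>e - {v}. f u)"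
  proof (rule sum.UNION_disjoint)
    show "finite D" using D finite_E finite_subset by blast
    show "\<forall>e\<in>D. finite (e - {v})" using D finite_edge by blast
    show "\<forall>e\<in>D. \<forall>e'\<in>D. e \<noteq> e' \<longrightarrow> (e - {v}) \<inter> (e' - {v}) = {}"
      using D edge_eqI by blast
  qed
  ultimately show ?thesis by simp
qed

lemma card_star:
  assumes F: "F \<subseteq> E" and v: "v \<in> \<Union>F"
  shows "card (\<Union>{e \<in> F. v \<in> e}) = 1 + degree F v * (s - 1)"
proof -
  let ?D = "{e \<in> F. v \<in> e}"
  have fin: "finite (\<Union>?D)" using finite_vertices by (rule rev_finite_subset) (use F in blast)
  have "real (card ((\<Union>?D) - {v})) = (\<Sum>u\<in>(\<Union>?D) - {v}. 1)" by simp
  also have "\<dots> = (\<Sum>e\<in>?D. \<Sum>u\<in>e - {v}. 1)"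
    by (rule sum_Union_star) (use F in auto)
  also have "\<dots> = (\<Sum>e\<in>?D. real (s - 1))"
    by (rule sum.cong) (use F card_edge finite_edge in auto)
  finally have "real (card ((\<Union>?D) - {v})) = real (degree F v * (s - 1))"
    by (simp add: degree_def)
  then have "card ((\<Union>?D) - {v}) = degree F v * (s - 1)" by (simp only: of_nat_eq_iff)
  moreover have "v \<in> \<Union>?D" using v by blast
  then have "card (\<Union>?D) = Suc (card ((\<Union>?D) - {v}))"
    using fin by (simp only: card_Suc_Diff1)
  ultimately show ?thesis by simp
qed

text \<open>The vector \<open>z = load y\<close> satisfies \<open>\<Sum>z = s\<close> and \<open>\<Sum>z\<^sup>2 = 1\<close>, so some positive entry \<open>z v\<close> is at
  most \<open>1/s\<close>. Every edge has load 1, whereas the \<open>d\<close> edges through \<open>v\<close> share only \<open>v\<close> and therefore carry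
  at most \<open>s + (d - 1) z v\<close> together.\<close>

lemma critical_degree:
  assumes F: "F \<subseteq> E" and y: "solves F y 1" and t: "\<And>v. load y v \<noteq> 0 \<Longrightarrow> t \<le> degree F v"
  shows "t \<le> s + 1" "t = s + 1 \<Longrightarrow> affine_planes F"
proof -
  define z where "z = load y"
  have z0: "z v \<ge> 0" for v unfolding z_def using y by (intro load_nonneg) (simp add: solves_def)
  have zF: "v \<in> \<Union>F" if "z v \<noteq> 0" for v
    using load_nonzero[of y v F] that y unfolding z_def solves_def by blast
  have sumz: "(\<Sum>v\<in>\<Union>E. z v) = s" using sum_load[of y] y by (simp add: z_def solves_def)
  have sumsq: "(\<Sum>v\<in>\<Union>E. z v * z v) = 1"
    using solves_form[OF y] by (simp add: form_def z_def)
  have edge: "(\<Sum>v\<in>e. z v) = 1" if "e \<in> F" for e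
    using y that unfolding solves_def gram_def z_def by blast
  have s0: "real s > 0" "real s - 1 > 0" using s_ge_2 by simp_all
  have deg: "real (degree F v) * (1 - z v) \<le> s - z v" if v: "v \<in> \<Union>F" for v
  proof -
    let ?D = "{e \<in> F. v \<in> e}"
    have "real (degree F v) = (\<Sum>e\<in>?D. \<Sum>u\<in>e. z u)"
      using edge by (simp add: degree_def)
    also have "\<dots> = (\<Sum>e\<in>?D. z v + (\<Sum>u\<in>e - {v}. z u))"
    proof (rule sum.cong[OF refl])
      fix e assume "e \<in> ?D"
      then have "finite e" "v \<in> e" using F finite_edge by blast+
      then show "(\<Sum>u\<in>e. z u) = z v + (\<Sum>u\<in>e - {v}. z u)" by (rule sum.remove)
    qed
    also have "\<dots> = degree F v * z v + (\<Sum>u\<in>(\<Union>?D) - {v}. z u)"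
    proof -
      have "?D \<subseteq> E" "\<And>e. e \<in> ?D \<Longrightarrow> v \<in> e" using F by blast+
      from sum_Union_star[OF this z0] show ?thesis by (simp only: sum.distrib) (simp add: degree_def)
    qed
    also have "(\<Sum>u\<in>(\<Union>?D) - {v}. z u) \<le> (\<Sum>u\<in>\<Union>E - {v}. z u)"
      using F z0 finite_vertices by (intro sum_mono2) auto
    also have "(\<Sum>u\<in>\<Union>E - {v}. z u) = s - z v"
    proof -
      have "v \<in> \<Union>E" using v F by blast
      from sum.remove[OF finite_vertices this, of z] show ?thesis using sumz by simp
    qed
    finally show ?thesis by (simp add: algebra_simps)
  qed
  have exv: "\<exists>v. 0 < z v \<and> z v \<le> 1 / s"
  proof (rule ccontr)
    assume neg: "\<not> ?thesis"
    \<comment> \<open>If every positive entry exceeded \<open>1 / s\<close>, this inequality would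
      be strict somewhere, and summing it would give \<open>s < s\<close>.\<close>
    have le: "z v \<le> s * (z v * z v)" for v
    proof (cases "z v = 0")
      case False
      then have "1 / s < z v" using neg z0[of v] by (metis less_eq_real_def not_le)
      then have "1 \<le> s * z v" using s0 by (simp add: field_simps)
      then show ?thesis using z0[of v] mult_right_mono[of 1 "s * z v" "z v"] by (simp add: mult.assoc)
    qed simp
    have "\<exists>w\<in>\<Union>E. z w \<noteq> 0" using sumz s0 by (metis sum.neutral less_irrefl)
    then obtain w where w: "w \<in> \<Union>E" "z w \<noteq> 0" by blast
    then have wpos: "0 < z w" using z0[of w] by simp
    then have "1 / s < z w" using neg by (metis not_le)
    then have "1 < s * z w" using s0 by (simp add: field_simps)
    then have lt: "z w < s * (z w * z w)"
      using wpos mult_strict_right_mono[of 1 "s * z w" "z w"] by (simp add: mult.assoc)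
    have "(\<Sum>v\<in>\<Union>E. z v) < (\<Sum>v\<in>\<Union>E. s * (z v * z v))"
      by (rule sum_strict_mono_ex1[OF finite_vertices]) (use le lt w in blast)+
    then show False using sumz sumsq by (simp add: sum_distrib_left[symmetric])
  qed
  have degle: "degree F v \<le> s + 1" if "0 < z v" "z v \<le> 1 / s" for v
  proof -
    have "v \<in> \<Union>F" using zF[of v] that by simp
    define d where "d = real (degree F v)"
    \<comment> \<open>Since \<open>z v \<le> 1 / s\<close>, the factor \<open>1 - z v\<close> is at
      least \<open>(s - 1) / s\<close>, which leaves \<open>d - 1 \<le> s\<close>.\<close>
    have d: "(d - 1) * (1 - z v) \<le> real s - 1"
      using deg[OF \<open>v \<in> \<Union>F\<close>] by (simp add: d_def algebra_simps)
    have "d - 1 \<le> s"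
    proof (rule ccontr)
      assume "\<not> d - 1 \<le> s"
      then have c: "s < d - 1" by simp
      have "1 - 1 / s \<le> 1 - z v" "0 < 1 - 1 / s" using that s0 by simp_all
      then have "s * (1 - 1 / s) < (d - 1) * (1 - z v)"
        using c s0 by (intro mult_less_le_imp_less) simp_all
      moreover have "s * (1 - 1 / s) = real s - 1" using s0 by (simp add: algebra_simps)
      ultimately show False using d by simp
    qed
    then show ?thesis by (simp add: d_def)
  qed
  obtain v0 where v0: "0 < z v0" "z v0 \<le> 1 / s" using exv by blast
  then show "t \<le> s + 1" using degle[of v0] t[of v0] by (simp add: z_def)
  assume ts: "t = s + 1"
  \<comment> \<open>Now every support vertex has degree at least \<open>s + 1\<close>, and the
    degree estimate becomes a lower bound for \<open>z v\<close>.\<close>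
  have ge: "1 / s \<le> z v" if "0 < z v" for v
  proof (rule ccontr)
    assume lt: "\<not> 1 / s \<le> z v"
    have "v \<in> \<Union>F" using zF[of v] that by simp
    have "s + 1 \<le> degree F v" using t[of v] that ts by (simp add: z_def)
    moreover have "1 / real s \<le> 1" using s0 by simp
    then have "z v < 1" using lt by linarith
    ultimately have "(real s + 1) * (1 - z v) \<le> degree F v * (1 - z v)"
      by (intro mult_right_mono) simp_all
    then have "(real s + 1) * (1 - z v) \<le> s - z v" using deg[OF \<open>v \<in> \<Union>F\<close>] by simp
    then have "1 \<le> s * z v" by (simp add: algebra_simps)
    then show False using lt s0 by (simp add: field_simps)
  qed
  \<comment> \<open>The terms \<open>z u * (z u - 1 / s)\<close> are nonnegative by
    \<open>ge\<close> and sum to \<open>1 - s / s = 0\<close>.\<close>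
  have zval: "z v = 0 \<or> z v = 1 / s" if v: "v \<in> \<Union>E" for v
  proof -
    have nn: "0 \<le> z u * (z u - 1 / s)" for u using ge[of u] z0[of u] by (cases "z u = 0") simp_all
    have "(\<Sum>u\<in>\<Union>E. z u * (z u - 1 / s)) = (\<Sum>u\<in>\<Union>E. z u * z u) - (\<Sum>u\<in>\<Union>E. z u) / s"
      by (simp add: algebra_simps sum_subtractf sum_divide_distrib)
    also have "\<dots> = 0" using sumz sumsq s0 by simp
    finally have "z v * (z v - 1 / s) = 0"
      using sum_nonneg_eq_0_iff[OF finite_vertices, of "\<lambda>u. z u * (z u - 1 / s)"] nn v by blast
    then show ?thesis by simp
  qed
  \<comment> \<open>An edge with a vertex of load 0 would carry at most \<open>(s - 1) / s\<close>,
    less than the required 1.\<close>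
  have onF: "z v = 1 / s" if vF: "v \<in> \<Union>F" for v
  proof (rule ccontr)
    assume ne: "z v \<noteq> 1 / s"
    obtain e where e: "e \<in> F" "v \<in> e" using vF by blast
    have eE: "e \<in> E" using e F by blast
    have "z v = 0" using zval[of v] ne eE e by blast
    moreover have "(\<Sum>u\<in>e. z u) = z v + (\<Sum>u\<in>e - {v}. z u)"
      using finite_edge[OF eE] e(2) by (rule sum.remove)
    moreover have "(\<Sum>u\<in>e - {v}. z u) \<le> of_nat (card (e - {v})) * (1 / s)"
      using zval eE s0 by (intro sum_bounded_above) fastforce
    moreover have "card (e - {v}) = s - 1" using card_edge[OF eE] e finite_edge[OF eE] by simp
    ultimately have "1 \<le> (real s - 1) / s" using edge[OF e(1)] s_ge_2 by (simp add: of_nat_diff)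
    then show False using s0 by (simp add: field_simps)
  qed
  have FE: "\<Union>F \<subseteq> \<Union>E" using F by blast
  have "real s = (\<Sum>v\<in>\<Union>F. z v)"
    unfolding sumz[symmetric] using FE finite_vertices zF by (intro sum.mono_neutral_right) blast+
  also have "\<dots> = card (\<Union>F) * (1 / s)" using onF by simp
  finally have "real (card (\<Union>F)) = real (s\<^sup>2)" using s0 by (simp add: field_simps power2_eq_square)
  then have cF: "card (\<Union>F) = s\<^sup>2" by (simp only: of_nat_eq_iff)
  \<comment> \<open>At least \<open>s + 1\<close> edges through \<open>v\<close> cover at least
    \<open>1 + (s + 1) * (s - 1) = s\<^sup>2\<close> points, which is all of them.\<close>
  have star: "\<Union>{e \<in> F. v \<in> e} = \<Union>F" if v: "v \<in> \<Union>F" for v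
  proof (rule card_seteq)
    show "finite (\<Union>F)" using FE finite_vertices finite_subset by blast
    show "\<Union>{e \<in> F. v \<in> e} \<subseteq> \<Union>F" by blast
    have "load y v \<noteq> 0" using onF[OF v] s0 by (simp add: z_def)
    then have "s + 1 \<le> degree F v" using t ts by blast
    then have "1 + (s + 1) * (s - 1) \<le> card (\<Union>{e \<in> F. v \<in> e})"
      unfolding card_star[OF F v] by (intro add_left_mono mult_right_mono) simp_all
    moreover have "1 + (s + 1) * (s - 1) = s\<^sup>2"
      using s_ge_2 by (cases s) (simp_all add: power2_eq_square algebra_simps)
    ultimately show "card (\<Union>F) \<le> card (\<Union>{e \<in> F. v \<in> e})" using cF by simp
  qed
  show "affine_planes F"
    unfolding affine_planes_def
  proof (intro ballI conjI)
    fix v assume v: "v \<in> \<Union>F"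
    show "card (\<Union>{e \<in> F. v \<in> e}) = s\<^sup>2" using star[OF v] cF by simp
    fix x w assume "x \<in> \<Union>{e \<in> F. v \<in> e}" "w \<in> \<Union>{e \<in> F. v \<in> e}"
    then have "x \<in> \<Union>F" "w \<in> \<Union>F" by blast+
    then have "w \<in> \<Union>{e \<in> F. x \<in> e}" using star by simp
    then show "\<exists>e\<in>F. x \<in> e \<and> w \<in> e" by blast
  qed
qed

section \<open>Classification along the cotree\<close>

text \<open>Here \<open>M\<close> is the number \<open>s\<close>, so the kernel is trivial and the
  solution total is \<open>1 / s\<close>; the inequality of \<open>light\<close> is an
  equality.\<close>

lemma light_singleton:
  assumes e: "e \<in> E"
  shows "light {e}"
proof -
  define y where "y f = (if f = e then 1 / s else 0 :: real)" for f
  have s0: "real s > 0" using s_ge_2 by simp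
  have "total y = (\<Sum>f\<in>E. if f = e then 1 / s else 0)" by (simp add: total_def y_def)
  then have ty: "total y = 1 / s" using e finite_E by simp
  have gy: "gram x e = real s * x e" if "supported x {e}" for x
  proof -
    have "gram x e = (\<Sum>f\<in>E. if f = e then real s * x e else 0)"
      unfolding gram_eq_sum_inter[OF finite_edge[OF e]]
      by (rule sum.cong) (use that card_edge[OF e] in \<open>auto simp: supported_def\<close>)
    then show ?thesis using e finite_E by simp
  qed
  have sy: "supported y {e}" by (simp add: supported_def y_def)
  have "solves {e} y (1 / s)"
    unfolding solves_def using sy gy[OF sy] ty s0 by (simp add: y_def)
  moreover have "determines {e} {}"
    unfolding determines_def
  proof (intro conjI allI impI)
    fix x f assume "supported x {e}" "\<forall>f\<in>{e}. gram x f = 0"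
    then show "x f = 0" using gy[of x] s0 by (cases "f = e") (auto simp: supported_def)
  qed simp
  ultimately show ?thesis unfolding light_def using s_ge_2
    by (intro exI[of _ y], intro exI[of _ "1 / real s"], intro exI[of _ "{}"]) simp
qed

lemma kernel_boundedI:
  assumes "determines F S" "(s + 1) * card S < card F"
  shows "kernel_bounded F"
  using assms unfolding kernel_bounded_def by (intro exI[of _ S]) simp

text \<open>The positive term \<open>s * a\<close> makes the bound strict, so light families never
  attain equality.\<close>

lemma light_kernel_bounded: 
  assumes "light F"
  shows "\<exists>S. determines F S \<and> (s + 1) * card S < card F"
proof -
  obtain y a S where "0 < a" "determines F S"
    and le: "real s * a + real ((s + 1) * card S) \<le> real (card F)"
    using assms unfolding light_def by blast
  moreover have "0 < real s * a" using s_ge_2 \<open>0 < a\<close> by simp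
  then have "real ((s + 1) * card S) < real (card F)" using le by linarith
  ultimately show ?thesis by (metis of_nat_less_iff)
qed

text \<open>The estimate \<open>t \<le> s + 1\<close> absorbs the surplus \<open>t\<close>, and
  equality in the bound forces \<open>t = s + 1\<close>.\<close>

lemma critical_kernel_bounded:
  assumes F: "F \<subseteq> E" and c: "critical F"
  shows "kernel_bounded F"
proof -
  obtain y t S where y: "solves F y 1" and t: "\<forall>v. load y v \<noteq> 0 \<longrightarrow> t \<le> degree F v"
    and S: "determines F S" and le: "(s + 1) * card S + (s + 1) \<le> card F + t"
    using c unfolding critical_def by blast
  have t1: "t \<le> s + 1" and t2: "t = s + 1 \<Longrightarrow> affine_planes F"
    using critical_degree[OF F y] t by blast+
  have "(s + 1) * card S \<le> card F" using le t1 by linarith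
  moreover have "affine_planes F" if "(s + 1) * card S = card F"
    by (rule t2) (use le that t1 in linarith)
  ultimately show ?thesis using S unfolding kernel_bounded_def by blast
qed

lemma rigid_light: "light F \<Longrightarrow> rigid F"
  unfolding light_def using rigid_solves by (metis less_irrefl)

section \<open>Disjoint unions\<close>

lemma affine_planes_Un:
  assumes s: "separated P Q" and "affine_planes P" "affine_planes Q"
  shows "affine_planes (P \<union> Q)"
  unfolding affine_planes_def
proof (intro ballI)
  fix v assume v: "v \<in> \<Union>(P \<union> Q)"
  have star: "{e \<in> P \<union> Q. v \<in> e} = {e \<in> R. v \<in> e}"
    if "R = P \<and> v \<in> \<Union>P \<or> R = Q \<and> v \<in> \<Union>Q" for R
    using s that unfolding separated_def by blast
  obtain R where R: "R = P \<and> v \<in> \<Union>P \<or> R = Q \<and> v \<in> \<Union>Q" using v by blast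
  then have "affine_planes R" "v \<in> \<Union>R" "R \<subseteq> P \<union> Q" using assms by blast+
  then show "card (\<Union>{e \<in> P \<union> Q. v \<in> e}) = s\<^sup>2 \<and>
     (\<forall>x\<in>\<Union>{e \<in> P \<union> Q. v \<in> e}. \<forall>y\<in>\<Union>{e \<in> P \<union> Q. v \<in> e}. \<exists>e\<in>P \<union> Q. x \<in> e \<and> y \<in> e)"
    unfolding star[OF R] affine_planes_def by blast
qed

lemma card_Un_mult_le: "(s + 1) * card (S \<union> T) \<le> (s + 1) * card S + (s + 1) * card T"
  using mult_le_mono2[OF card_Un_le[of S T], of "s + 1"] by (simp only: distrib_left)

text \<open>The bounds add, so equality for the union forces equality in both parts.\<close>

lemma kernel_bounded_separated:
  assumes s: "separated P Q" and P: "kernel_bounded P" and Q: "kernel_bounded Q"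
  shows "kernel_bounded (P \<union> Q)"
proof -
  obtain S where S: "determines P S" "(s + 1) * card S \<le> card P"
    "(s + 1) * card S = card P \<longrightarrow> affine_planes P" using P unfolding kernel_bounded_def by blast
  obtain T where T: "determines Q T" "(s + 1) * card T \<le> card Q"
    "(s + 1) * card T = card Q \<longrightarrow> affine_planes Q" using Q unfolding kernel_bounded_def by blast
  have c: "card (P \<union> Q) = card P + card Q" using s card_Un_parts[of P Q] by (simp add: separated_def)
  have "affine_planes (P \<union> Q)" if "(s + 1) * card (S \<union> T) = card (P \<union> Q)"
  proof -
    have "(s + 1) * card S = card P" "(s + 1) * card T = card Q"
      using that c S(2) T(2) card_Un_mult_le[of S T] by linarith+
    then show ?thesis using affine_planes_Un[OF s] S T by blast
  qed
  moreover have "(s + 1) * card (S \<union> T) \<le> card (P \<union> Q)"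
    using c S(2) T(2) card_Un_mult_le[of S T] by linarith
  ultimately show ?thesis using separated_determines[OF s S(1) T(1)] unfolding kernel_bounded_def by blast
qed

text \<open>The alternatives stand for solution total below, equal to and above 1; in the last case
  only the kernel bound itself is carried along.\<close>

definition classified :: "'v set set \<Rightarrow> bool" where
  "classified F \<longleftrightarrow> light F \<or> critical F \<or> dense F \<and> kernel_bounded F"

lemma classifiedI:
  "light F \<Longrightarrow> classified F" "critical F \<Longrightarrow> classified F" "dense F \<Longrightarrow> kernel_bounded F \<Longrightarrow> classified F"
  unfolding classified_def by blast+

lemma classified_kernel_bounded:
  assumes "F \<subseteq> E" "classified F"
  shows "kernel_bounded F"
  using assms light_kernel_bounded kernel_boundedI critical_kernel_bounded unfolding classified_def by blast

lemma classified_solves: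
  assumes "classified F" "\<not> dense F"
  obtains y a where "solves F y a" "0 < a" "a \<le> 1" "a = 1 \<longrightarrow> critical F" "a < 1 \<longrightarrow> light F"
proof -
  consider "light F" | "critical F" using assms unfolding classified_def by blast
  then show thesis
  proof cases
    case 1
    then obtain y a where "solves F y a" "0 < a" "a < 1" unfolding light_def by blast
    then show ?thesis using that[of y a] 1 by simp
  next
    case 2
    then obtain y where "solves F y 1" unfolding critical_def by blast
    then show ?thesis using that[of y 1] 2 by simp
  qed
qed

lemma light_separated:
  assumes s: "separated P Q" and P: "light P" and Q: "light Q"
  shows "classified (P \<union> Q)"
proof -
  obtain x a S where x: "solves P x a" "0 < a" "a < 1" "determines P S"
    "real s * a + real ((s + 1) * card S) \<le> real (card P)" using P unfolding light_def by blast
  obtain y b T where y: "solves Q y b" "0 < b" "b < 1" "determines Q T"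
    "real s * b + real ((s + 1) * card T) \<le> real (card Q)" using Q unfolding light_def by blast
  define z where "z = (\<lambda>e. 1 * x e + 1 * y e)"
  have z: "solves (P \<union> Q) z (a + b)" unfolding z_def by (rule solves_separated[OF s x(1) y(1)])
  have d: "determines (P \<union> Q) (S \<union> T)" by (rule separated_determines[OF s x(4) y(4)])
  have "card (P \<union> Q) = card P + card Q" using s card_Un_parts[of P Q] by (simp add: separated_def)
  moreover have "real ((s + 1) * card (S \<union> T)) \<le> real ((s + 1) * card S) + real ((s + 1) * card T)"
    using card_Un_mult_le[of S T] by (metis of_nat_add of_nat_le_iff)
  ultimately have le: "real s * (a + b) + real ((s + 1) * card (S \<union> T)) \<le> real (card (P \<union> Q))"
    using x(5) y(5) by (simp add: algebra_simps)
  consider "a + b < 1" | "a + b = 1" | "a + b > 1" by linarith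
  then show ?thesis
  proof cases
    case 1
    then have "light (P \<union> Q)" 
      unfolding light_def using z d le 1 add_pos_pos[OF x(2) y(2)]
      by (intro exI[of _ z] exI[of _ "a + b"] exI[of _ "S \<union> T"] conjI)
    then show ?thesis by (rule classifiedI)
  next
    \<comment> \<open>A part of total 1 has arisen without a join, so \<open>t = 1\<close>. The
      inequality for total 1 has \<open>s\<close> where \<open>critical\<close> has
      \<open>s + 1\<close>; adding 1 on both sides makes them agree.\<close>
    case 2
    have fin: "finite (P \<union> Q)"
      by (rule finite_subset[OF _ finite_E]) (use s in \<open>simp add: separated_def\<close>)
    have "1 \<le> degree (P \<union> Q) v" if v: "load z v \<noteq> 0" for v
    proof -
      obtain e where "e \<in> P \<union> Q" "v \<in> e"
        using load_nonzero[OF v] z unfolding solves_def by blast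
      then have "{e \<in> P \<union> Q. v \<in> e} \<noteq> {}" by blast
      then show ?thesis unfolding degree_def using fin by (simp add: Suc_le_eq card_gt_0_iff)
    qed
    moreover have "real s + real ((s + 1) * card (S \<union> T)) \<le> real (card (P \<union> Q))"
      using le 2 by simp
    then have "(s + 1) * card (S \<union> T) + (s + 1) \<le> card (P \<union> Q) + 1"
      by (simp only: of_nat_add[symmetric] of_nat_le_iff)
    ultimately have "critical (P \<union> Q)"
      unfolding critical_def using z[unfolded 2] d
      by (intro exI[of _ z] exI[of _ "1::nat"] exI[of _ "S \<union> T"] conjI allI impI)
    then show ?thesis by (rule classifiedI)
  next
    case 3
    have "kernel_bounded (P \<union> Q)"
      using kernel_bounded_separated[OF s] light_kernel_bounded[OF P] light_kernel_bounded[OF Q] kernel_boundedI by blast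
    then show ?thesis by (rule classifiedI(3)[OF solves_dense[OF z 3]])
  qed
qed

lemma classified_separated:
  assumes s: "separated P Q" and P: "classified P" and Q: "classified Q"
  shows "classified (P \<union> Q)"
proof -
  have sub: "P \<subseteq> E" "Q \<subseteq> E" using s by (auto simp: separated_def)
  have kernel_bounded: "kernel_bounded (P \<union> Q)"
    using kernel_bounded_separated[OF s classified_kernel_bounded[OF sub(1) P] classified_kernel_bounded[OF sub(2) Q]] .
  show ?thesis
  proof (cases "dense P \<or> dense Q")
    case True
    then have "dense (P \<union> Q)" using dense_mono by blast
    then show ?thesis using kernel_bounded by (rule classifiedI)
  next
    case False
    obtain x a where x: "solves P x a" "0 < a" "a \<le> 1" "a < 1 \<longrightarrow> light P"
      using classified_solves[OF P] False by metis
    obtain y b where y: "solves Q y b" "0 < b" "b \<le> 1" "b < 1 \<longrightarrow> light Q"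
      using classified_solves[OF Q] False by metis
    show ?thesis
    proof (cases "a < 1 \<and> b < 1")
      case True
      then show ?thesis using light_separated[OF s] x y by blast
    next
      case F: False
      \<comment> \<open>One total equals 1 and the other is positive.\<close>
      then have "a + b > 1" using x y by linarith
      then have "dense (P \<union> Q)" using solves_dense[OF solves_separated[OF s x(1) y(1)]] by blast
      then show ?thesis using kernel_bounded by (rule classifiedI)
    qed
  qed
qed

section \<open>Joins\<close>

lemma light_joined:
  assumes j: "joined P Q" and P: "light P" and Q: "light Q"
  shows "light (P \<union> Q)"
proof -
  obtain x a S where x: "solves P x a" "0 < a" "a < 1" "determines P S"
    "real s * a + real ((s + 1) * card S) \<le> real (card P)" using P unfolding light_def by blast
  obtain y b T where y: "solves Q y b" "0 < b" "b < 1" "determines Q T"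
    "real s * b + real ((s + 1) * card T) \<le> real (card Q)" using Q unfolding light_def by blast
  define c where "c = (a + b - 2 * a * b) / (1 - a * b)"
  have ab1: "a * b < 1" using mult_strict_mono[of a 1 b 1] x y by simp
  have "a * b < a" "a * b < b" using x y by simp_all
  then have c0: "0 < c" using ab1 by (simp add: c_def)
  have "0 < (1 - a) * (1 - b)" using x y by simp
  then have c1: "c < 1" using ab1 by (simp add: c_def algebra_simps)
  \<comment> \<open>Clearing the denominator in \<open>c \<le> a + b\<close> leaves exactly this
    inequality.\<close>
  have "a * b * (a + b) \<le> a * b * 2" using x y by (intro mult_left_mono) simp_all
  then have c2: "c \<le> a + b" using ab1 by (simp add: c_def pos_divide_le_eq algebra_simps)
  have d: "determines (P \<union> Q) (S \<union> T)"
    using joined_determines[OF j _ x(4) y(4)] rigid_light P by blast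
  have "card (P \<union> Q) = card P + card Q" using j card_Un_parts[of P Q] by (simp add: joined_def)
  moreover have "real ((s + 1) * card (S \<union> T)) \<le> real ((s + 1) * card S) + real ((s + 1) * card T)"
    using card_Un_mult_le[of S T] by (metis of_nat_add of_nat_le_iff)
  moreover have "real s * c \<le> real s * (a + b)" using c2 by (rule mult_left_mono) simp
  ultimately have "real s * c + real ((s + 1) * card (S \<union> T)) \<le> real (card (P \<union> Q))"
    using x(5) y(5) by (simp add: algebra_simps)
  then show ?thesis
    using solves_joined[OF j x(1) y(1) x(2,3) y(2,3), folded c_def] d c0 c1
    unfolding light_def by blast
qed

lemma degree_Un:
  assumes "P \<subseteq> E" "Q \<subseteq> E" "P \<inter> Q = {}"
  shows "degree (P \<union> Q) v = degree P v + degree Q v"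
proof -
  have "{e \<in> P \<union> Q. v \<in> e} = {e \<in> P. v \<in> e} \<union> {e \<in> Q. v \<in> e}" by blast
  then show ?thesis
    unfolding degree_def using card_Un_parts[of "{e \<in> P. v \<in> e}" "{e \<in> Q. v \<in> e}"] assms by auto
qed

text \<open>The solution \<open>x\<close> of \<open>P\<close> solves the whole join, since its total
  1 is also its value on every edge of \<open>Q\<close>. As \<open>Q\<close> is rigid, no kernel
  vectors are added.\<close>

lemma critical_light_joined:
  assumes j: "joined P Q" and P: "critical P" and Q: "light Q"
  shows "critical (P \<union> Q)"
proof -
  obtain x t S where x: "solves P x 1" "\<forall>v. load x v \<noteq> 0 \<longrightarrow> t \<le> degree P v"
    "determines P S" "(s + 1) * card S + (s + 1) \<le> card P + t"
    using P unfolding critical_def by blast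
  obtain T where T: "determines Q T" "(s + 1) * card T < card Q" using light_kernel_bounded[OF Q] by blast
  have sub: "P \<subseteq> E" "Q \<subseteq> E" "P \<inter> Q = {}" using j by (auto simp: joined_def)
  have "determines (P \<union> Q) (S \<union> T)"
    using joined_determines[OF j _ x(3) T(1)] rigid_light Q by blast
  moreover have "(s + 1) * card (S \<union> T) + (s + 1) \<le> card (P \<union> Q) + t"
    using x(4) T(2) card_Un_mult_le[of S T] card_Un_parts[OF sub] by linarith
  moreover have "solves (P \<union> Q) x 1"
    using x(1) joined_gram[OF joined_sym[OF j], of x] supported_mono[of x P "P \<union> Q"]
    unfolding solves_def by auto
  moreover have "\<forall>v. load x v \<noteq> 0 \<longrightarrow> t \<le> degree (P \<union> Q) v"
    using x(2) degree_Un[OF sub] by (metis trans_le_add1)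
  ultimately show ?thesis unfolding critical_def by blast
qed

text \<open>The difference of the two solutions has form \<open>1 - 2 + 1 = 0\<close>, so their
  loads agree and degrees on the common support add up to at least \<open>t + u\<close>. The new
  kernel dimension costs \<open>s + 1\<close>, one of the two summands \<open>s + 1\<close> supplied
  by the parts.\<close>

lemma critical_joined:
  assumes j: "joined P Q" and P: "critical P" and Q: "critical Q"
  shows "critical (P \<union> Q)"
proof -
  obtain x t S where x: "solves P x 1" "\<forall>v. load x v \<noteq> 0 \<longrightarrow> t \<le> degree P v"
    "determines P S" "(s + 1) * card S + (s + 1) \<le> card P + t"
    using P unfolding critical_def by blast
  obtain y u T where y: "solves Q y 1" "\<forall>v. load y v \<noteq> 0 \<longrightarrow> u \<le> degree Q v"
    "determines Q T" "(s + 1) * card T + (s + 1) \<le> card Q + u"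
    using Q unfolding critical_def by blast
  have sub: "P \<subseteq> E" "Q \<subseteq> E" "P \<inter> Q = {}" using j by (auto simp: joined_def)
  have "form x y = 1" using joined_form[OF j, of x y] x(1) y(1) by (simp add: solves_def)
  then have "form (\<lambda>e. 1 * x e + (- 1) * y e) (\<lambda>e. 1 * x e + (- 1) * y e) = 0"
    unfolding form_square_lin using solves_form[OF x(1)] solves_form[OF y(1)] by simp
  from form_zero(1)[OF this] have "1 * load x v + (- 1) * load y v = 0" for v
    unfolding load_lin .
  then have same: "load y v = load x v" for v by (simp add: algebra_simps)
  obtain U where U: "determines (P \<union> Q) U" "card U \<le> card S + card T + 1"
    using joined_determines_insert[OF j x(3) y(3)] by blast
  have "(s + 1) * card U \<le> (s + 1) * card S + (s + 1) * card T + (s + 1)"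
    using mult_le_mono2[OF U(2), of "s + 1"] by (simp only: distrib_left mult_1_right)
  then have "(s + 1) * card U + (s + 1) \<le> card (P \<union> Q) + (t + u)"
    using x(4) y(4) card_Un_parts[OF sub] by linarith
  moreover have "solves (P \<union> Q) x 1"
    using x(1) joined_gram[OF joined_sym[OF j], of x] supported_mono[of x P "P \<union> Q"]
    unfolding solves_def by auto
  moreover have "\<forall>v. load x v \<noteq> 0 \<longrightarrow> t + u \<le> degree (P \<union> Q) v"
    using x(2) y(2) degree_Un[OF sub] same by (metis add_mono)
  ultimately show ?thesis using U(1) unfolding critical_def by blast
qed

text \<open>Positive semidefiniteness leaves only a light partner. Its strict kernel bound makes the
  bound for the join strict, so the equality clause holds vacuously.\<close>

lemma dense_joined:
  assumes j: "joined P Q" and P: "classified P" "dense P" and Q: "classified Q"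
  shows "classified (P \<union> Q)"
proof -
  have sub: "P \<subseteq> E" "Q \<subseteq> E" "P \<inter> Q = {}" using j by (auto simp: joined_def)
  have "\<not> dense Q"
  proof
    assume "dense Q"
    then obtain y where y: "supported y Q" "form y y < (total y)\<^sup>2" unfolding dense_def by blast
    then have "total y \<noteq> 0" using form_nonneg[of y] by auto
    then show False using dense_joined_contra[OF j P(2) y(1)] y(2) by simp
  qed
  then obtain y b where y: "solves Q y b" "0 < b" "b \<le> 1" "b = 1 \<longrightarrow> critical Q" "b < 1 \<longrightarrow> light Q"
    using classified_solves[OF Q] by blast
  have "b \<noteq> 1"
  proof
    assume "b = 1"
    then show False
      using dense_joined_contra[OF j P(2), of y] y(1) solves_form[OF y(1)] by (simp add: solves_def)
  qed
  then have "light Q" using y by simp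
  then obtain T where T: "determines Q T" "(s + 1) * card T < card Q" using light_kernel_bounded by blast
  obtain S where S: "determines P S" "(s + 1) * card S \<le> card P"
    using classified_kernel_bounded[OF sub(1) P(1)] unfolding kernel_bounded_def by blast
  have "determines (P \<union> Q) (S \<union> T)"
    using joined_determines[OF j _ S(1) T(1)] rigid_dense P(2) by blast
  moreover have "(s + 1) * card (S \<union> T) < card (P \<union> Q)"
    using S(2) T(2) card_Un_mult_le[of S T] card_Un_parts[OF sub] by linarith
  ultimately have "kernel_bounded (P \<union> Q)" by (rule kernel_boundedI)
  with dense_mono[OF P(2), of "P \<union> Q"] show ?thesis by (intro classifiedI) blast
qed

lemma classified_joined:
  assumes j: "joined P Q" and P: "classified P" and Q: "classified Q"
  shows "classified (P \<union> Q)"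
proof (cases "dense P \<or> dense Q")
  case True
  then show ?thesis
    using dense_joined[OF j P _ Q] dense_joined[OF joined_sym[OF j] Q _ P] by (metis sup_commute)
next
  case False
  then have "light P \<or> critical P" "light Q \<or> critical Q" using P Q by (auto simp: classified_def)
  then show ?thesis
    using light_joined[OF j] critical_joined[OF j] critical_light_joined[OF j]
      critical_light_joined[OF joined_sym[OF j]]
    unfolding classified_def by (metis sup_commute)
qed

text \<open>Single edges are the leaves of the cotree; a larger family splits by Seinsche's theorem
  into two joined or two separated parts.\<close>

lemma classified_cograph:
  assumes "F \<subseteq> E" "F \<noteq> {}" "\<not> P4_in F line_adj"
  shows "classified F"
  using assms
proof (induction "card F" arbitrary: F rule: less_induct)
  case less
  have fin: "finite F" using less.prems(1) finite_E by (rule finite_subset)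
  show ?case
  proof (cases "card F \<ge> 2")
    case False
    then have "card F = 1" using less.prems fin by (simp add: card_gt_0_iff less_2_cases_iff not_le)
    then obtain e where "F = {e}" using card_1_singletonE by blast
    then show ?thesis using light_singleton less.prems by (simp add: classified_def)
  next
    case True
    have adj: "symp (line_adj :: 'v set \<Rightarrow> _)" "irreflp (line_adj :: 'v set \<Rightarrow> _)"
      by (auto simp: symp_def irreflp_def line_adj_def)
    have parts: "classified P \<and> classified Q"
      if "P \<noteq> {}" "Q \<noteq> {}" "P \<inter> Q = {}" "P \<union> Q = F" for P Q
    proof -
      have "P \<subset> F" "Q \<subset> F" using that by blast+
      then have "card P < card F" "card Q < card F" using fin psubset_card_mono by blast+
      moreover have "\<not> P4_in P line_adj" "\<not> P4_in Q line_adj"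
        using less.prems(3) that unfolding P4_in_def by blast+
      moreover have "P \<subseteq> E" "Q \<subseteq> E" using that less.prems by blast+
      ultimately show ?thesis using less.hyps that by blast
    qed
    from no_P4_join[OF fin adj less.prems(3) True] show ?thesis
    proof
      assume "is_join F line_adj"
      then obtain P Q where PQ: "P \<noteq> {}" "Q \<noteq> {}" "P \<inter> Q = {}" "P \<union> Q = F"
        "\<forall>p\<in>P. \<forall>q\<in>Q. line_adj p q" unfolding is_join_def by blast
      then have "joined P Q" using less.prems unfolding joined_def line_adj_def by blast
      then show ?thesis using classified_joined parts[OF PQ(1-4)] PQ(4) by blast
    next
      assume "is_join F (co_adj line_adj)"
      then obtain P Q where PQ: "P \<noteq> {}" "Q \<noteq> {}" "P \<inter> Q = {}" "P \<union> Q = F"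
        "\<forall>p\<in>P. \<forall>q\<in>Q. p \<noteq> q \<and> \<not> line_adj p q" unfolding is_join_def by blast
      then have "separated P Q" using less.prems unfolding separated_def line_adj_def by blast
      then show ?thesis using classified_separated parts[OF PQ(1-4)] PQ(4) by blast
    qed
  qed
qed

section \<open>Rank and components\<close>

text \<open>The rows outside \<open>S\<close> are independent: a dependency among them, extended by
  zero, is a kernel vector vanishing on \<open>S\<close>.\<close>

lemma determines_card_le_rank:
  assumes S: "determines E S" and es: "distinct es" "set es = E" and vs: "set vs = \<Union>E"
  shows "card E - card S \<le> mat_rank (incidence_matrix es vs)"
proof -
  let ?A = "incidence_matrix es vs" and ?n = "length es"
  define R where "R = {i. i < ?n \<and> es ! i \<notin> S}"
  have SE: "S \<subseteq> E" using S by (rule determines_subset)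
  have bij: "bij_betw ((!) es) {..<?n} E" using bij_betw_nth[OF es(1) refl es(2)[symmetric]] .
  have R: "R \<subseteq> {..<?n}" by (auto simp: R_def)
  have img: "(!) es ` R = E - S"
    using bij unfolding R_def bij_betw_def by auto
  have "inj_on ((!) es) R" using bij R unfolding bij_betw_def by (meson inj_on_subset)
  from card_image[OF this] have cR: "card R = card E - card S"
    unfolding img using card_Diff_subset[OF _ SE] finite_subset[OF SE finite_E] by simp
  have "card R \<le> vec_space.rank ?n ?A"
  proof (rule card_independent_rows_le_rank[OF _ R])
    show "?A \<in> carrier_mat ?n (length vs)" by (simp add: incidence_matrix_def)
    fix x :: "nat \<Rightarrow> real" and i
    assume off: "\<And>i. i \<notin> R \<Longrightarrow> x i = 0" and ker: "\<And>j. j < length vs \<Longrightarrow> (\<Sum>i\<in>R. x i * ?A $$ (i, j)) = 0"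
      and i: "i \<in> R"
    \<comment> \<open>The coefficients are carried from row indices to edges.\<close>
    define X where "X e = (if e \<in> E then x (inv_into {..<?n} ((!) es) e) else 0)" for e
    have X: "X (es ! k) = x k" if "k < ?n" for k
      using that bij bij_betw_inv_into_left[OF bij, of k] es(2) by (auto simp: X_def)
    have "load X v = 0" if v: "v \<in> \<Union>E" for v
    proof -
      obtain j where j: "j < length vs" "vs ! j = v" using v vs by (metis in_set_conv_nth)
      have "load X v = (\<Sum>k<?n. if v \<in> es ! k then X (es ! k) else 0)"
        unfolding load_def by (rule sum.reindex_bij_betw[OF bij, symmetric])
      also have "\<dots> = (\<Sum>k<?n. x k * ?A $$ (k, j))"
        by (rule sum.cong[OF refl]) (simp add: X incidence_matrix_def j)
      also have "\<dots> = (\<Sum>k\<in>R. x k * ?A $$ (k, j))"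
        by (rule sum.mono_neutral_right) (use R off in auto)
      finally show ?thesis using ker[OF j(1)] by simp
    qed
    then have "gram X e = 0" if "e \<in> E" for e
      unfolding gram_def by (intro sum.neutral) (use that in blast)
    moreover have "X e = 0" if eS: "e \<in> S" for e
    proof -
      obtain k where k: "k < ?n" "es ! k = e" using eS SE es(2) by (metis in_set_conv_nth subsetD)
      then have "k \<notin> R" using eS by (simp add: R_def)
      then show ?thesis using X[OF k(1)] off[of k] k(2) by simp
    qed
    moreover have "supported X E" unfolding supported_def X_def by simp
    ultimately have "X (es ! i) = 0" using determinesD[OF S] by metis
    moreover have "i < ?n" using i R by blast
    ultimately show "x i = 0" using X[of i] by simp
  qed
  then show ?thesis by (simp add: cR mat_rank_def incidence_matrix_def)
qed

lemma kernel_bounded_empty: "kernel_bounded {}"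
  unfolding kernel_bounded_def
  by (intro exI[of _ "{}"]) (simp add: determines_def supported_def affine_planes_def)

lemma sum_degree: "(\<Sum>v\<in>\<Union>E. degree E v) = s * card E"
proof -
  have "(\<Sum>v\<in>\<Union>E. degree E v) = (\<Sum>v\<in>\<Union>E. \<Sum>e\<in>E. if v \<in> e then 1 else 0)"
    unfolding degree_def using finite_E by (simp add: sum.If_cases Int_def)
  also have "\<dots> = (\<Sum>e\<in>E. \<Sum>v\<in>\<Union>E. if v \<in> e then 1 else 0)" by (rule sum.swap)
  also have "\<dots> = (\<Sum>e\<in>E. s)"
  proof (rule sum.cong[OF refl])
    fix e assume e: "e \<in> E"
    then have "{v \<in> \<Union>E. v \<in> e} = e" by blast
    then show "(\<Sum>v\<in>\<Union>E. if v \<in> e then 1 else 0) = s"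
      using finite_vertices card_edge[OF e] by (simp add: sum.If_cases Int_def)
  qed
  finally show ?thesis by simp
qed

end

section \<open>Components and Steiner systems\<close>

lemma coedge_rel_edge: "e \<in> edges H \<Longrightarrow> x \<in> e \<Longrightarrow> y \<in> e \<Longrightarrow> (x, y) \<in> coedge_rel H"
  unfolding coedge_rel_def by blast

lemma sym_coedge_rel: "sym (coedge_rel H)"
  unfolding coedge_rel_def sym_def by blast

lemma edge_subset_component:
  assumes "e \<in> edges H" "x \<in> e" "x \<in> (coedge_rel H)\<^sup>* `` {u}"
  shows "e \<subseteq> (coedge_rel H)\<^sup>* `` {u}"
proof
  fix y assume "y \<in> e"
  then have "(x, y) \<in> coedge_rel H" using assms coedge_rel_edge by metis
  then show "y \<in> (coedge_rel H)\<^sup>* `` {u}" using assms(3) by (auto intro: rtrancl_into_rtrancl)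
qed

lemma uniform_linear_family_edges:
  assumes "s \<ge> 2" "finite_hypergraph H" "linear_hypergraph H" "uniform_hypergraph s H"
  shows "uniform_linear_family (edges H) s"
proof
  show "finite (edges H)"
    using assms(2) unfolding finite_hypergraph_def
    by (intro finite_subset[of "edges H" "Pow (verts H)"]) auto
qed (use assms in \<open>auto simp: linear_hypergraph_def uniform_hypergraph_def\<close>)

text \<open>Any two points of a star are collinear, so \<open>star v\<close> lies in the star of
  each of its points, and equal cardinality makes these stars equal. Walking along edges therefore
  never leaves a star, which makes the component a star.\<close>

lemma affine_planes_components:
  assumes H: "s \<ge> 2" "finite_hypergraph H" "linear_hypergraph H" "uniform_hypergraph s H"
    and aff: "uniform_linear_family.affine_planes s (edges H)"
    and C: "C \<in> components H" "edges C \<noteq> {}"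
  shows "steiner_2_system s (s\<^sup>2) C"
proof -
  interpret uniform_linear_family "edges H" s by (rule uniform_linear_family_edges[OF H])
  let ?E = "edges H" and ?r = "coedge_rel H"
  obtain u where u: "C = (?r\<^sup>* `` {u}, {e \<in> ?E. e \<subseteq> ?r\<^sup>* `` {u}})"
    using C(1) unfolding components_def by blast
  define K where "K = ?r\<^sup>* `` {u}"
  have CK: "C = (K, {e \<in> ?E. e \<subseteq> K})" using u by (simp add: K_def)
  define star where "star v = \<Union>{e \<in> ?E. v \<in> e}" for v
  have card_st: "card (star v) = s\<^sup>2" and pair: "x \<in> star v \<Longrightarrow> y \<in> star v \<Longrightarrow> \<exists>e\<in>?E. x \<in> e \<and> y \<in> e"
    if "v \<in> \<Union>?E" for v x y
    using aff that unfolding affine_planes_def star_def by blast+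
  have fin_st: "finite (star v)" for v
    unfolding star_def by (rule finite_subset[OF _ finite_vertices]) blast
  have star_eq: "star x = star v" if v: "v \<in> \<Union>?E" and x: "x \<in> star v" for v x
  proof -
    have "star v \<subseteq> star x"
    proof
      fix y assume "y \<in> star v"
      then show "y \<in> star x" using pair[OF v x] unfolding star_def by blast
    qed
    moreover have "x \<in> \<Union>?E" using x unfolding star_def by blast
    then have "card (star x) \<le> card (star v)" using card_st v by simp
    ultimately show ?thesis using card_seteq[OF fin_st] by blast
  qed
  \<comment> \<open>This edge supplies a base point \<open>w\<close> known to lie on an edge, which
    replaces \<open>u\<close>.\<close>
  obtain e0 where e0: "e0 \<in> ?E" "e0 \<subseteq> K" using C(2) CK by auto
  have "e0 \<noteq> {}" using card_edge[OF e0(1)] H(1) by auto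
  then obtain w where w: "w \<in> e0" by blast
  have wE: "w \<in> \<Union>?E" and wK: "w \<in> K" using w e0 by blast+
  have "star w \<subseteq> K"
    using edge_subset_component[of _ H w u] wK unfolding star_def K_def by blast
  moreover have "K \<subseteq> star w"
  proof
    fix y assume y: "y \<in> K"
    have "(u, w) \<in> ?r\<^sup>*" using wK by (simp add: K_def)
    then have "(w, u) \<in> ?r\<^sup>*" by (rule symD[OF sym_rtrancl[OF sym_coedge_rel]])
    then have "(w, y) \<in> ?r\<^sup>*" using y unfolding K_def by (auto intro: rtrancl_trans)
    then show "y \<in> star w"
    proof (induction rule: rtrancl_induct)
      case base
      then show ?case using w e0 unfolding star_def by blast
    next
      case (step y z)
      have "z \<in> star y" using step.hyps(2) unfolding star_def coedge_rel_def by blast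
      then show ?case using star_eq[OF wE step.IH] by simp
    qed
  qed
  ultimately have K: "K = star w" by blast
  have KV: "K \<subseteq> \<Union>?E" unfolding K star_def by blast
  show ?thesis
    unfolding steiner_2_system_def CK
  proof (intro conjI ballI impI)
    show "finite_hypergraph (K, {e \<in> ?E. e \<subseteq> K})"
      using fin_st[of w] K by (simp add: finite_hypergraph_def)
    show "card (verts (K, {e \<in> ?E. e \<subseteq> K})) = s\<^sup>2" using card_st[OF wE] K by simp
    show "uniform_hypergraph s (K, {e \<in> ?E. e \<subseteq> K})"
      using card_edge by (simp add: uniform_hypergraph_def)
    fix x y assume "x \<in> verts (K, {e \<in> ?E. e \<subseteq> K})" "y \<in> verts (K, {e \<in> ?E. e \<subseteq> K})" and ne: "x \<noteq> y"
    then have xy: "x \<in> star w" "y \<in> star w" using K by simp_all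
    obtain e where e: "e \<in> ?E" "x \<in> e" "y \<in> e" using pair[OF wE xy] by blast
    have "e \<subseteq> star x" using e unfolding star_def by blast
    then have "e \<subseteq> K" using star_eq[OF wE xy(1)] K by simp
    then show "\<exists>!B. B \<in> edges (K, {e \<in> ?E. e \<subseteq> K}) \<and> x \<in> B \<and> y \<in> B"
      using e ne by (intro ex1I[of _ e]) (simp, simp, metis edge_eqI)
  qed
qed

text \<open>In a Steiner component the edges through a point cover all \<open>s\<^sup>2\<close>
  points and overlap only there, so each degree is \<open>s + 1\<close>; counting incidences in two
  ways gives the identity.\<close>

lemma steiner_components_count:
  assumes H: "s \<ge> 2" "finite_hypergraph H" "linear_hypergraph H" "uniform_hypergraph s H"
    and st: "\<And>C. C \<in> components H \<Longrightarrow> edges C \<noteq> {} \<Longrightarrow> steiner_2_system s (s\<^sup>2) C"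
  shows "(s + 1) * card (\<Union>(edges H)) = s * card (edges H)"
proof -
  interpret uniform_linear_family "edges H" s by (rule uniform_linear_family_edges[OF H])
  let ?E = "edges H" and ?r = "coedge_rel H"
  have "degree ?E v = s + 1" if v: "v \<in> \<Union>?E" for v
  proof -
    define K where "K = ?r\<^sup>* `` {v}"
    obtain e where e: "e \<in> ?E" "v \<in> e" using v by blast
    have vK: "v \<in> K" unfolding K_def by blast
    have eK: "f \<subseteq> K" if "f \<in> ?E" "v \<in> f" for f
      using edge_subset_component[of f H v v] that vK unfolding K_def by blast
    have "v \<in> verts H" using H(2) e unfolding finite_hypergraph_def by blast
    then have "(K, {e \<in> ?E. e \<subseteq> K}) \<in> components H" unfolding components_def K_def by blast
    moreover have "edges (K, {e \<in> ?E. e \<subseteq> K}) \<noteq> {}" using eK[OF e] e(1) by auto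
    ultimately have S: "steiner_2_system s (s\<^sup>2) (K, {e \<in> ?E. e \<subseteq> K})" by (rule st)
    have "\<Union>{f \<in> ?E. v \<in> f} = K"
    proof
      show "\<Union>{f \<in> ?E. v \<in> f} \<subseteq> K" using eK by blast
      show "K \<subseteq> \<Union>{f \<in> ?E. v \<in> f}"
      proof
        fix y assume y: "y \<in> K"
        show "y \<in> \<Union>{f \<in> ?E. v \<in> f}"
        proof (cases "y = v")
          case True
          then show ?thesis using e by blast
        next
          case False
          then have "\<exists>!B. B \<in> {e \<in> ?E. e \<subseteq> K} \<and> v \<in> B \<and> y \<in> B"
            using S y vK unfolding steiner_2_system_def by simp
          then show ?thesis by blast
        qed
      qed
    qed
    then have "1 + degree ?E v * (s - 1) = s\<^sup>2"
      using card_star[OF order_refl v] S unfolding steiner_2_system_def by simp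
    moreover have "s\<^sup>2 = 1 + (s + 1) * (s - 1)"
      using H(1) by (cases s) (simp_all add: power2_eq_square algebra_simps)
    ultimately have "degree ?E v * (s - 1) = (s + 1) * (s - 1)" by linarith
    moreover have "s - 1 \<noteq> 0" using H(1) by simp
    ultimately show ?thesis by (metis mult_right_cancel)
  qed
  then have "(\<Sum>v\<in>\<Union>?E. degree ?E v) = (s + 1) * card (\<Union>?E)" by simp
  then show ?thesis using sum_degree by simp
qed

theorem theorem2p7:
  fixes H :: "'v hypergraph" and s :: nat and es :: "'v set list" and vs :: "'v list"
  assumes "s \<ge> 2"
    and "finite_hypergraph H"
    and "linear_hypergraph H"
    and "uniform_hypergraph s H"
    and "cograph (edges H) line_adj"
    and "incidence_orderings H es vs"
  shows "(s + 1) * mat_rank (incidence_matrix es vs) \<ge> s * card (edges H) \<and>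
    ((s + 1) * mat_rank (incidence_matrix es vs) = s * card (edges H) \<longleftrightarrow>
      (\<forall>C \<in> components H. edges C \<noteq> {} \<longrightarrow> steiner_2_system s (s\<^sup>2) C))"
proof -
  note H = assms(1-4)
  interpret uniform_linear_family "edges H" s by (rule uniform_linear_family_edges[OF H])
  let ?E = "edges H" and ?rk = "mat_rank (incidence_matrix es vs)"
  have es: "distinct es" "set es = ?E" and dvs: "distinct vs" and "set vs = nonisolated_verts H"
    using assms(6) by (simp_all add: incidence_orderings_def)
  moreover have "nonisolated_verts H = \<Union>?E"
    using assms(2) unfolding nonisolated_verts_def finite_hypergraph_def by blast
  ultimately have vs: "set vs = \<Union>?E" by simp
  have adj: "symp (line_adj :: 'v set \<Rightarrow> _)" "irreflp (line_adj :: 'v set \<Rightarrow> _)"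
    by (auto simp: symp_def irreflp_def line_adj_def)
  have "\<not> P4_in ?E line_adj"
    using assms(5) P4_in_imp_induced_P4[OF adj] unfolding cograph_def by blast
  then have "kernel_bounded ?E"
    using kernel_bounded_empty classified_kernel_bounded[OF order_refl classified_cograph[OF order_refl]]
    by (cases "?E = {}") simp_all
  then obtain S where S: "determines ?E S" "(s + 1) * card S \<le> card ?E"
    "(s + 1) * card S = card ?E \<longrightarrow> affine_planes ?E" unfolding kernel_bounded_def by blast
  have "card ?E \<le> ?rk + card S" using determines_card_le_rank[OF S(1) es vs] by linarith
  from mult_le_mono2[OF this, of "s + 1"]
  have le: "(s + 1) * card ?E \<le> (s + 1) * ?rk + (s + 1) * card S" by (simp only: distrib_left)
  have ex: "(s + 1) * card ?E = s * card ?E + card ?E" by simp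
  have lower: "s * card ?E \<le> (s + 1) * ?rk" using le ex S(2) by linarith
  have "\<forall>C \<in> components H. edges C \<noteq> {} \<longrightarrow> steiner_2_system s (s\<^sup>2) C"
    if "(s + 1) * ?rk = s * card ?E"
  proof -
    \<comment> \<open>Equality for the rank leaves no slack in the kernel bound.\<close>
    have "(s + 1) * card S = card ?E" using that le ex S(2) by linarith
    then have "affine_planes ?E" using S(3) by blast
    then show ?thesis using affine_planes_components[OF H] by blast
  qed
  \<comment> \<open>For the converse, the rank is at most the number of columns, and the incidence
    count turns this into the upper bound matching \<open>lower\<close>.\<close>
  moreover have "(s + 1) * ?rk = s * card ?E"
    if "\<forall>C \<in> components H. edges C \<noteq> {} \<longrightarrow> steiner_2_system s (s\<^sup>2) C"
  proof -
    have "incidence_matrix es vs \<in> carrier_mat (length es) (length vs)"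
      by (simp add: incidence_matrix_def)
    then have "?rk \<le> length vs"
      unfolding mat_rank_def by (metis carrier_matD(1) vec_space.rank_le_nc)
    also have "length vs = card (\<Union>?E)" using distinct_card[OF dvs] vs by simp
    finally have "(s + 1) * ?rk \<le> (s + 1) * card (\<Union>?E)" by (rule mult_le_mono2)
    also have "\<dots> = s * card ?E" using steiner_components_count[OF H] that by blast
    finally show ?thesis using lower by (rule le_antisym)
  qed
  ultimately show ?thesis using lower by blast
qed

end
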